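(* Let $\boldsymbol X(t)$, $t\in\mathcal T=\mathbb R^p$, be a $d$-dimensional max-stable process with index $\alpha>0$, Fréchet marginals, sample paths in $C$ and spectral process $\boldsymbol Z$ (with sample paths in $C$) such that $$\mathbb P\Bigl\{\sup_{t\in\mathcal T}\|\boldsymbol Z(t)\|>0\Bigr\}=1,\qquad \mathbb E\{\|\boldsymbol Z(t)\|^\alpha\}=1\quad\text{for all } t\in\mathcal T .$$ For $h\in\mathcal T$ let $\boldsymbol\Theta^{[h]}$ be the tilted process of $\boldsymbol Z$ at $h$, and let $\widetilde{\boldsymbol Z}$ be a random process with sample paths in $C$. (i) If $\widetilde{\boldsymbol Z}$ is a spectral process of $\boldsymbol X$ such that $\mathbb P\{\sup_{t\in\mathcal T}\|\widetilde{\boldsymbol Z}(t)\|>0\}=1$, then $$\mathbb E\{H(\boldsymbol Z)\}=\mathbb E\{H(\widetilde{\boldsymbol Z})\}\qquad\text{for all } H\in E_\alpha .$$ Conversely, if $\mathbb E\{\|\boldsymbol Z(h)\|^\alpha\}=\mathbb E\{\|\widetilde{\boldsymbol Z}(h)\|^\alpha\}=1$ for all $h\in\mathcal T$, and $$\mathbb E\{\|\boldsymbol Z(h)\|^\alpha\,\Gamma(\boldsymbol Z)\}=\mathbb E\{\|\widetilde{\boldsymbol Z}(h)\|^\alpha\,\Gamma(\widetilde{\boldsymbol Z})\}\qquad\text{for all }\Gamma\in E_0,\ h\in\mathcal T,$$ then the max-stable processes $\boldsymbol X$ and $\widetilde{\boldsymbol X}$ (with the same index $\alpha$) having spectral processes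 $\boldsymbol Z$ and $\widetilde{\boldsymbol Z}$, respectively, are equal in law. (ii) For every $T_0$-valued random variable $W$ with probability mass function $p(t)>0$, $t\in T_0$, independent of everything else, the random process $$\boldsymbol Z_W(t)=\frac{1}{\bigl(\sum_{s\in T_0}\|\boldsymbol\Theta^{[W]}(s)\|^\alpha p(s)\bigr)^{1/\alpha}}\ \boldsymbol\Theta^{[W]}(t),\qquad t\in\mathcal T,$$ is a spectral process for $\boldsymbol X$.
   Context: Here $d,p$ are positive integers, $\mathcal T=\mathbb R^p$, $T_0=\mathbb Q^p$, and $\|\cdot\|$ is a fixed norm on $\mathbb R^d$. $C$ is the space of all continuous functions $f:\mathcal T\to[0,\infty)^d$, equipped with the $\sigma$-field $\mathcal C$ generated by the projection maps $f\mapsto f(t)$, $t\in T_0$ (this is the Borel $\sigma$-field of a Polish topology on $C$). Max-stable process and spectral process: let $\alpha>0$ and let $\boldsymbol Z(t)=(Z_1(t),\ldots,Z_d(t))$, $t\in\mathcal T$, be a random process with sample paths in $C$. $\boldsymbol Z$ is called a spectral process of (or for) the max-stable process $\boldsymbol X$ with index $\alpha$ if $\boldsymbol X$ has the same law as $$\max_{i\ge1}\Gamma_i^{-1/\alpha}\boldsymbol Z^{(i)}(t),\quad t\in\mathcal T\quad(\text{componentwise maximum}),$$ where $\Gamma_i=\sum_{k=1}^iE_k$ with $E_k$, $k\ge1$, independent unit exponential random variables, independent of $\boldsymbol Z^{(i)}$, $i\ge1$, which are independent copies of $\boldsymbol Z$. Fréchet marginals means that each $X_k(t)$ has distribution function $x\mapsto\exp(-a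 x^{-\alpha})$, $x>0$, with $a=\mathbb E\{Z_k^\alpha(t)\}\in(0,\infty)$. Homogeneous maps: for $\beta\ge0$, $E_\beta$ is the class of all measurable maps $H:C\to[0,\infty]$ that are $\beta$-homogeneous, i.e. $H(cf)=c^\beta H(f)$ for all $c>0$, $f\in C$. Tilted process: $\boldsymbol\Theta^{[h]}$ is a random process with sample paths in $C$ whose law is $$\mathbb P\{\boldsymbol\Theta^{[h]}\in A\}=\frac{1}{\mathbb E\{\|\boldsymbol Z(h)\|^\alpha\}}\mathbb E\bigl\{\|\boldsymbol Z(h)\|^\alpha\,\mathbb I(\boldsymbol Z/\|\boldsymbol Z(h)\|\in A)\bigr\},\quad A\in\mathcal C,$$ where $\mathbb I$ denotes the indicator function and expressions multiplied by $\|\boldsymbol Z(h)\|^\alpha$ are taken as $0$ when $\|\boldsymbol Z(h)\|=0$. The processes $\boldsymbol\Theta^{[h]}$ are taken independent and defined on the same probability space; $W$ is independent of all of them, and $\boldsymbol\Theta^{[W]}$ equals $\boldsymbol\Theta^{[h]}$ on $\{W=h\}$. *)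

theory Defs
  imports "HOL-Probability.Probability"
begin

section \<open>Norms on Euclidean space and the path space\<close>

text \<open>
  The type class norm on \<^typ>\<open>real ^ 'd\<close> is the Euclidean one; the results are about an arbitrary
  norm, so it is a function subject to the norm axioms.
\<close>

definition is_norm :: "(real ^ 'd \<Rightarrow> real) \<Rightarrow> bool" where
  "is_norm nrm \<longleftrightarrow>
     (\<forall>x. 0 \<le> nrm x) \<and>
     (\<forall>x. nrm x = 0 \<longleftrightarrow> x = 0) \<and>
     (\<forall>c x. nrm (c *\<^sub>R x) = \<bar>c\<bar> * nrm x) \<and>
     (\<forall>x y. nrm (x + y) \<le> nrm x + nrm y)"

definition rational_points :: "(real ^ 'p) set" where
  "rational_points = {t. \<forall>i. t $ i \<in> \<rat>}"

definition paths :: "(real ^ 'p \<Rightarrow> real ^ 'd) set" where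
  "paths = {f. continuous_on UNIV f \<and> (\<forall>t k. 0 \<le> f t $ k)}"

text \<open>Only the measurable structure of this measure matters, its values are irrelevant.\<close>

definition path_space :: "(real ^ 'p \<Rightarrow> real ^ 'd) measure" where
  "path_space =
     sigma paths {{f \<in> paths. f t \<in> B} | t B. t \<in> rational_points \<and> B \<in> sets borel}"

definition path_process :: "'a measure \<Rightarrow> ('a \<Rightarrow> real ^ 'p \<Rightarrow> real ^ 'd) \<Rightarrow> bool" where
  "path_process M Z \<longleftrightarrow> prob_space M \<and> Z \<in> M \<rightarrow>\<^sub>M path_space"

definition homogeneous_maps :: "real \<Rightarrow> ((real ^ 'p \<Rightarrow> real ^ 'd) \<Rightarrow> ennreal) set" where
  "homogeneous_maps \<beta> =
     {H \<in> borel_measurable path_space.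
        \<forall>c > 0. \<forall>f \<in> paths. H (\<lambda>t. c *\<^sub>R f t) = ennreal (c powr \<beta>) * H f}"


section \<open>Max-stable processes and their spectral processes\<close>

text \<open>A process with values in $[0,\infty)^d$ and no assumption on the regularity of its paths.\<close>

definition nonneg_process :: "'a measure \<Rightarrow> ('a \<Rightarrow> real ^ 'p \<Rightarrow> real ^ 'd) \<Rightarrow> bool" where
  "nonneg_process M X \<longleftrightarrow>
     prob_space M \<and>
     (\<forall>t. (\<lambda>\<omega>. X \<omega> t) \<in> borel_measurable M) \<and>
     (\<forall>\<omega> \<in> space M. \<forall>t k. 0 \<le> X \<omega> t $ k)"

text \<open>
  The law of a process indexed by all of \<^typ>\<open>real ^ 'p\<close> is its distribution on the product
  $\sigma$-field; two such laws agree iff all finite-dimensional distributions do. For processes with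
  paths in \<^const>\<open>paths\<close> this is the same as equality of the distributions on \<^const>\<open>path_space\<close>.
  Components are read in $[0,\infty]$ because the maximum below can be infinite on a null set.
\<close>

definition process_law ::
    "'a measure \<Rightarrow> ('a \<Rightarrow> real ^ 'p \<Rightarrow> real ^ 'd) \<Rightarrow> ((real ^ 'p) \<times> 'd \<Rightarrow> ennreal) measure" where
  "process_law M X = distr M (PiM UNIV (\<lambda>_. borel)) (\<lambda>\<omega> (t, k). ennreal (X \<omega> t $ k))"

text \<open>
  The law of $\max_i \Gamma_i^{-1/\alpha} Z^{(i)}$, where $Z$ has law \<open>Q\<close>, realised on the canonical
  product space carrying the independent exponential variables and copies of $Z$. Indices start
  at 0, so $\Gamma_{i+1}$ is \<open>\<Sum>j\<le>i. e j\<close>.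
\<close>

definition max_stable_law ::
    "real \<Rightarrow> (real ^ 'p \<Rightarrow> real ^ 'd) measure \<Rightarrow> ((real ^ 'p) \<times> 'd \<Rightarrow> ennreal) measure" where
  "max_stable_law \<alpha> Q =
     distr
       (PiM (UNIV :: nat set) (\<lambda>_. density lborel (\<lambda>x. ennreal (exponential_density 1 x)))
          \<Otimes>\<^sub>M PiM (UNIV :: nat set) (\<lambda>_. Q))
       (PiM UNIV (\<lambda>_. borel))
       (\<lambda>(e, z) (t, k). SUP i. ennreal ((\<Sum>j\<le>i. e j) powr (- 1 / \<alpha>) * z i t $ k))"

text \<open>
  \<open>Z\<close> (on \<open>N\<close>) is a spectral process of \<open>X\<close> (on \<open>M\<close>) with index \<open>\<alpha>\<close>; the two processes need not
  live on the same probability space.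
\<close>

definition spectral_process ::
    "real \<Rightarrow> 'x measure \<Rightarrow> ('x \<Rightarrow> real ^ 'p \<Rightarrow> real ^ 'd) \<Rightarrow>
     'z measure \<Rightarrow> ('z \<Rightarrow> real ^ 'p \<Rightarrow> real ^ 'd) \<Rightarrow> bool" where
  "spectral_process \<alpha> M X N Z \<longleftrightarrow>
     nonneg_process M X \<and> path_process N Z \<and>
     process_law M X = max_stable_law \<alpha> (distr N path_space Z)"

definition frechet_marginals ::
    "real \<Rightarrow> 'x measure \<Rightarrow> ('x \<Rightarrow> real ^ 'p \<Rightarrow> real ^ 'd) \<Rightarrow>
     'z measure \<Rightarrow> ('z \<Rightarrow> real ^ 'p \<Rightarrow> real ^ 'd) \<Rightarrow> bool" where
  "frechet_marginals \<alpha> M X N Z \<longleftrightarrow>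
     (\<forall>t k. \<exists>a > 0.
        (\<integral>\<^sup>+\<omega>. ennreal ((Z \<omega> t $ k) powr \<alpha>) \<partial>N) = ennreal a \<and>
        (\<forall>x > 0. measure M {\<omega> \<in> space M. X \<omega> t $ k \<le> x} = exp (- a * x powr (- \<alpha>))))"

definition sup_norm_pos ::
    "(real ^ 'd \<Rightarrow> real) \<Rightarrow> 'z measure \<Rightarrow> ('z \<Rightarrow> real ^ 'p \<Rightarrow> real ^ 'd) \<Rightarrow> bool" where
  "sup_norm_pos nrm N Z \<longleftrightarrow>
     measure N {\<omega> \<in> space N. (SUP t. ennreal (nrm (Z \<omega> t))) > 0} = 1"


section \<open>Tilted processes and the normalised mixture\<close>

text \<open>
  Where $\|Z(h)\| = 0$ the quotient $Z/\|Z(h)\|$ is the zero path by the convention \<open>inverse 0 = 0\<close>,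
  and the integrand vanishes.
\<close>

definition tilted_process ::
    "(real ^ 'd \<Rightarrow> real) \<Rightarrow> real \<Rightarrow> 'z measure \<Rightarrow> ('z \<Rightarrow> real ^ 'p \<Rightarrow> real ^ 'd) \<Rightarrow> real ^ 'p \<Rightarrow>
     'q measure \<Rightarrow> ('q \<Rightarrow> real ^ 'p \<Rightarrow> real ^ 'd) \<Rightarrow> bool" where
  "tilted_process nrm \<alpha> N Z h P \<Theta> \<longleftrightarrow>
     path_process P \<Theta> \<and>
     (\<forall>A \<in> sets path_space.
        emeasure P {\<omega> \<in> space P. \<Theta> \<omega> \<in> A} =
          (\<integral>\<^sup>+\<omega>. ennreal (nrm (Z \<omega> h) powr \<alpha>) *
                indicator A (\<lambda>t. inverse (nrm (Z \<omega> h)) *\<^sub>R Z \<omega> t) \<partial>N) /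
          (\<integral>\<^sup>+\<omega>. ennreal (nrm (Z \<omega> h) powr \<alpha>) \<partial>N))"

text \<open>
  Joint independence of \<open>W\<close> and all the $\Theta^{[h]}$, i.e. of the $\sigma$-fields they generate
  (\<open>None\<close> is the index of \<open>W\<close>); \<open>indep_vars\<close> does not apply since \<open>W\<close> and \<open>\<Theta> h\<close> have different types.
\<close>

definition indep_selector ::
    "'q measure \<Rightarrow> ('q \<Rightarrow> real ^ 'p) \<Rightarrow> (real ^ 'p \<Rightarrow> 'q \<Rightarrow> real ^ 'p \<Rightarrow> real ^ 'd) \<Rightarrow> bool" where
  "indep_selector P W \<Theta> \<longleftrightarrow>
     prob_space.indep_sets P
       (case_option
          (sets (vimage_algebra (space P) W (count_space rational_points)))
          (\<lambda>h. sets (vimage_algebra (space P) (\<Theta> h) path_space)))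
       UNIV"

text \<open>
  $Z_W$. If the series diverges, \<open>infsum\<close> is 0 and the path is the zero path, in agreement
  with $1/\infty = 0$.
\<close>

definition mixed_process ::
    "(real ^ 'd \<Rightarrow> real) \<Rightarrow> real \<Rightarrow> (real ^ 'p \<Rightarrow> real) \<Rightarrow>
     ('q \<Rightarrow> real ^ 'p) \<Rightarrow> (real ^ 'p \<Rightarrow> 'q \<Rightarrow> real ^ 'p \<Rightarrow> real ^ 'd) \<Rightarrow>
     'q \<Rightarrow> real ^ 'p \<Rightarrow> real ^ 'd" where
  "mixed_process nrm \<alpha> p W \<Theta> \<omega> t =
     (1 / (\<Sum>\<^sub>\<infinity>s\<in>rational_points. nrm (\<Theta> (W \<omega>) \<omega> s) powr \<alpha> * p s) powr (1 / \<alpha>))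
       *\<^sub>R \<Theta> (W \<omega>) \<omega> t"

end

theory Submission
  imports Defs
begin

text \<open>
  All comparisons of spectral processes go through the numbers
  $\mathbb E \max_j (Z_{k_j}(t_j)/x_j)^\alpha$. Conditioning on the first arrival shows that the
  probability that no marked arrival satisfies $V_i > \Gamma_i$ is $\exp(-\mathbb E V)$; with $V$ the above
  maximum this is the joint distribution function of the max-stable process, so its law and these
  numbers determine each other. Replacing the threshold at one coordinate by $y^{-1/\alpha}$ and
  taking the right derivative at $y = 1$ yields
  $\mathbb E \{Z_k(t)^\alpha \mathbb I(Z_{k_j}(t_j) \le x_j Z_k(t)\ \forall j)\}$, hence
  $\mathbb E \{Z_k(t)^\alpha G(Z)\}$ for all $0$-homogeneous $G$. Splitting the paths according to the
  first rational coordinate that does not vanish then gives $\mathbb E H(Z)$ for $\alpha$-homogeneous $H$, and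
  the same splitting with $\|Z(t)\|$ in place of the coordinates gives the converse. For $Z_W$, the
  weights $p(h) \|Z(h)\|^\alpha$ of the mixture add up to the normalising sum, which cancels.
\<close>

section \<open>Avoidance probability of a marked Poisson process\<close>

text \<open>The avoidance formula is the void probability of a Poisson process, obtained here by a
  recursion in the number of arrivals. For marks with finitely many values the recursion has an
  explicit fixed point, and it contracts because the marks are bounded: an arrival later than the
  largest mark is harmless. General marks, possibly of infinite mean, follow by monotone limits. The
  derivative is taken from the right so that ties count fully and the closed sets
  \<open>f t $ k \<le> x\<close> come out, which generate the path space and are stable under
  intersection. Dominated convergence and the uniqueness of measures rest on finite moments of the
  coordinates; this is where the Frechet marginals enter. The zero path is the delicate point: an
  \<alpha>-homogeneous map may be infinite there, while levels and weights vanish. The comparison of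
  all \<alpha>-homogeneous maps excludes it by positivity of the supremum; the converse and the
  mixture compare levels only. Continuity lets every splitting run over the countably many rational
  points.\<close>

abbreviation exp_measure :: "real measure" where
  "exp_measure \<equiv> density lborel (\<lambda>x. ennreal (exponential_density 1 x))"

lemma prob_space_exp_measure: "prob_space exp_measure"
  by (rule prob_space_exponential_density) simp

text \<open>Passes from the gauge integral to the nonnegative integral, so that exponential
  expectations can be evaluated by the fundamental theorem of calculus. Vanishing beyond
  \<open>L\<close> keeps the interval compact.\<close>

lemma nn_integral_exp_measure_has_integral:
  fixes g :: "real \<Rightarrow> real"
  assumes "g \<in> borel_measurable borel" and "0 \<le> L"
    and g: "\<And>s. 0 \<le> s \<Longrightarrow> 0 \<le> g s" "\<And>s. L < s \<Longrightarrow> g s = 0"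
    and I: "((\<lambda>s. exp (- s) * g s) has_integral I) {0..L}"
  shows "(\<integral>\<^sup>+s. ennreal (g s) \<partial>exp_measure) = ennreal I"
proof -
  have "(\<integral>\<^sup>+s. ennreal (g s) \<partial>exp_measure)
      = (\<integral>\<^sup>+s. ennreal (exponential_density 1 s) * ennreal (g s) \<partial>lborel)"
    using assms(1) by (subst nn_integral_density) auto
  also have "\<dots> = (\<integral>\<^sup>+s. ennreal (indicator {0..L} s * (exp (- s) * g s)) \<partial>lborel)"
    using g by (intro nn_integral_cong)
      (auto simp: exponential_density_def indicator_def ennreal_mult'[symmetric])
  also have "\<dots> = ennreal I"
    using nn_integral_has_integral_lebesgue[OF _ I] g by simp
  finally show ?thesis .
qed

lemma exp_measure_less:
  assumes "0 \<le> K"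
  shows "(\<integral>\<^sup>+s. indicator {s. s < K} s \<partial>exp_measure) = ennreal (1 - exp (- K))"
proof -
  have "((\<lambda>s. exp (- s)) has_integral (- exp (- K) - (- exp (- 0)))) {0..K}"
    by (rule fundamental_theorem_of_calculus)
       (use assms in \<open>auto intro!: derivative_eq_intros simp flip: has_real_derivative_iff_has_vector_derivative\<close>)
  then have "((\<lambda>s. exp (- s)) has_integral (1 - exp (- K))) {0..K}" by simp
  then have "((\<lambda>s. exp (- s) * indicator {s. s < K} s) has_integral (1 - exp (- K))) {0..K}"
    by (rule has_integral_spike_finite[rotated 2, where S="{K}"]) auto
  then have "(\<integral>\<^sup>+s. ennreal (indicator {s. s < K} s) \<partial>exp_measure) = ennreal (1 - exp (- K))"
    using assms by (intro nn_integral_exp_measure_has_integral[where L=K]) auto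
  then show ?thesis by (simp add: ennreal_indicator)
qed

section \<open>The recursion over arrivals for marks with finitely many values\<close>

definition cdf_on :: "real set \<Rightarrow> (real \<Rightarrow> real) \<Rightarrow> real \<Rightarrow> real" where
  "cdf_on S q u = (\<Sum>v\<in>S. if v \<le> u then q v else 0)"

text \<open>If \<open>q\<close> is the mass function of a variable V with values in
  \<open>S\<close>, this is E max 0 (V - u), the integral of P(V > s) over s > u. For arrivals at
  unit rate it is the mean number of those after time u whose mark exceeds their arrival
  time.\<close>

definition excess_on :: "real set \<Rightarrow> (real \<Rightarrow> real) \<Rightarrow> real \<Rightarrow> real" where
  "excess_on S q u = (\<Sum>v\<in>S. q v * max 0 (v - u))"

text \<open>The derivative of a tail integral is minus the tail probability, which is
  \<open>cdf_on S q u - 1\<close> because the masses sum to 1. At the values of the mark the excess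
  has kinks, hence the restriction on \<open>u\<close>.\<close>

lemma excess_on_deriv:
  assumes "finite S" "sum q S = 1" "u \<notin> S"
  shows "(excess_on S q has_real_derivative (cdf_on S q u - 1)) (at u)"
proof -
  have D: "((\<lambda>u. max 0 (v - u)) has_real_derivative (if v \<le> u then 0 else -1)) (at u)"
    if v: "v \<in> S" for v
  proof -
    consider "v < u" | "u < v" using v assms(3) by (metis linorder_neqE)
    then show ?thesis
    proof cases
      case 1
      have "((\<lambda>u. 0) has_real_derivative 0) (at u)" by simp
      moreover have "eventually (\<lambda>w. w \<in> {v<..}) (nhds u)"
        using 1 by (intro eventually_nhds_in_open) auto
      then have "eventually (\<lambda>w. 0 = max 0 (v - w)) (nhds u)" by eventually_elim auto
      ultimately show ?thesis using 1 DERIV_cong_ev[OF refl _ refl, of "\<lambda>u. 0" "\<lambda>w. max 0 (v - w)" u 0] by auto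
    next
      case 2
      have "((\<lambda>u. v - u) has_real_derivative -1) (at u)" by (auto intro!: derivative_eq_intros)
      moreover have "eventually (\<lambda>w. w \<in> {..<v}) (nhds u)"
        using 2 by (intro eventually_nhds_in_open) auto
      then have "eventually (\<lambda>w. v - w = max 0 (v - w)) (nhds u)" by eventually_elim auto
      ultimately show ?thesis using 2 DERIV_cong_ev[OF refl _ refl, of "\<lambda>u. v - u" "\<lambda>w. max 0 (v - w)" u "-1"] by auto
    qed
  qed
  have "((\<lambda>u. \<Sum>v\<in>S. q v * max 0 (v - u)) has_real_derivative (\<Sum>v\<in>S. q v * (if v \<le> u then 0 else -1))) (at u)"
    by (intro DERIV_sum DERIV_cmult D)
  moreover have "(\<Sum>v\<in>S. q v * (if v \<le> u then 0 else -1)) = cdf_on S q u - sum q S"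
    unfolding cdf_on_def sum_subtractf[symmetric] by (rule sum.cong) auto
  ultimately show ?thesis unfolding excess_on_def[abs_def] by (simp add: assms(2))
qed

lemma continuous_on_excess_on: "continuous_on A (\<lambda>s. excess_on S q (x + s))"
  unfolding excess_on_def by (intro continuous_intros)

lemma measurable_cdf_on[measurable]: "cdf_on S q \<in> borel_measurable borel"
  unfolding cdf_on_def[abs_def] by measurable

lemma measurable_excess_on[measurable]: "excess_on S q \<in> borel_measurable borel"
  unfolding excess_on_def[abs_def] by measurable

text \<open>Conditioning on the first arrival: \<open>\<lambda>x. exp (- excess_on S q x)\<close> is a fixed point of the
  recursion satisfied by the avoidance probabilities of the process started at \<open>x\<close>.\<close>

lemma exp_excess_fixpoint:
  assumes S: "finite S" and q: "sum q S = 1" "\<And>v. v \<in> S \<Longrightarrow> 0 \<le> q v"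
  shows "(\<integral>\<^sup>+s. ennreal (cdf_on S q (x + s) * exp (- excess_on S q (x + s))) \<partial>exp_measure)
       = ennreal (exp (- excess_on S q x))"
proof -
  interpret E: prob_space exp_measure by (rule prob_space_exp_measure)
  let ?F = "cdf_on S q" and ?B = "excess_on S q"
  have "\<exists>K. \<forall>v\<in>S. v \<le> K" using S by (meson Max_ge)
  then obtain K where K: "\<And>v. v \<in> S \<Longrightarrow> v \<le> K" by blast
  define L where "L = max 0 (K - x)"
  have F01: "0 \<le> ?F u" "?F u \<le> 1" for u
    unfolding cdf_on_def q(1)[symmetric] using q(2) by (auto intro!: sum_nonneg sum_mono)
  have B0: "0 \<le> ?B u" for u unfolding excess_on_def using q(2) by (auto intro!: sum_nonneg)
  have FK: "?F u = 1" "?B u = 0" if "u \<ge> K" for u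
  proof -
    show "?F u = 1" unfolding cdf_on_def q(1)[symmetric] using K that by (intro sum.cong) force+
    show "?B u = 0" unfolding excess_on_def using K that by (intro sum.neutral) force
  qed
  \<comment> \<open>The complement 1 - F exp (- B) is integrated because it vanishes beyond the
    largest mark. Its product with exp (- s) has the antiderivative \<open>?\<psi>\<close>, since B
    has derivative F - 1 off the finitely many kinks.\<close>
  let ?\<psi> = "\<lambda>s. - exp (- s) * (1 - exp (- ?B (x + s)))"
  have "((\<lambda>s. exp (- s) * (1 - ?F (x + s) * exp (- ?B (x + s)))) has_integral (?\<psi> L - ?\<psi> 0)) {0..L}"
  proof (rule fundamental_theorem_of_calculus_strong[where S = "(\<lambda>v. v - x) ` S"])
    fix s assume "s \<in> {0..L} - (\<lambda>v. v - x) ` S"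
    then have "x + s \<notin> S" by force
    have *: "((\<lambda>s. ?B (x + s)) has_real_derivative (?F (x + s) - 1)) (at s)"
      using excess_on_deriv[OF S q(1) \<open>x + s \<notin> S\<close>]
      using DERIV_shift[of ?B "?F (x + s) - 1" s x] by (simp add: add.commute)
    show "(?\<psi> has_vector_derivative exp (- s) * (1 - ?F (x + s) * exp (- ?B (x + s)))) (at s)"
      unfolding has_real_derivative_iff_has_vector_derivative[symmetric]
      by (rule derivative_eq_intros * refl | simp)+ (simp add: algebra_simps exp_minus)
  qed (use S in \<open>auto simp: L_def intro!: continuous_intros continuous_on_excess_on\<close>)
  moreover have "?\<psi> L - ?\<psi> 0 = 1 - exp (- ?B x)" using FK(2)[of "x + L"] by (simp add: L_def)
  ultimately have "(\<integral>\<^sup>+s. ennreal (1 - ?F (x + s) * exp (- ?B (x + s))) \<partial>exp_measure) = ennreal (1 - exp (- ?B x))"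
    using F01 B0 FK
    by (intro nn_integral_exp_measure_has_integral[where L=L]) (auto simp: L_def intro!: mult_le_one)
  moreover have "(\<integral>\<^sup>+s. ennreal (?F (x + s) * exp (- ?B (x + s))) \<partial>exp_measure)
      + (\<integral>\<^sup>+s. ennreal (1 - ?F (x + s) * exp (- ?B (x + s))) \<partial>exp_measure)
      = (\<integral>\<^sup>+s. 1 \<partial>exp_measure)"
    using F01 B0 by (subst nn_integral_add[symmetric], simp, simp, intro nn_integral_cong)
      (simp add: ennreal_plus[symmetric] mult_le_one del: ennreal_plus)
  moreover have "\<dots> = ennreal (1 - exp (- ?B x)) + ennreal (exp (- ?B x))"
    using B0 E.emeasure_space_1 by (simp add: ennreal_plus[symmetric] del: ennreal_plus)
  ultimately have "ennreal (1 - exp (- ?B x))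
      + (\<integral>\<^sup>+s. ennreal (?F (x + s) * exp (- ?B (x + s))) \<partial>exp_measure)
      = ennreal (1 - exp (- ?B x)) + ennreal (exp (- ?B x))"
    by (simp only: add.commute)
  then show ?thesis unfolding ennreal_add_left_cancel by simp
qed

text \<open>For \<open>F\<close> the distribution function of a mark, this is the probability that
  none of the first \<open>n\<close> marks exceeds its arrival time, the clock being started at
  \<open>x\<close>. The starting time is a variable because the recursion restarts the clock at the
  first arrival.\<close>

definition avoidance :: "(real \<Rightarrow> ennreal) \<Rightarrow> nat \<Rightarrow> real \<Rightarrow> ennreal" where
  "avoidance F n x = (\<integral>\<^sup>+e. (\<Prod>i<n. F (x + (\<Sum>j\<le>i. e j))) \<partial>PiM (UNIV :: nat set) (\<lambda>_. exp_measure))"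

text \<open>A sequence space is the product of one factor with a copy of itself; splitting off the
  first waiting time s leaves the same problem started at x + s.\<close>

lemma avoidance_Suc:
  assumes [measurable]: "F \<in> borel_measurable borel"
  shows "avoidance F (Suc n) x = (\<integral>\<^sup>+s. F (x + s) * avoidance F n (x + s) \<partial>exp_measure)"
proof -
  interpret E: prob_space exp_measure by (rule prob_space_exp_measure)
  interpret sequence_space exp_measure
    by unfold_locales
  have "avoidance F (Suc n) x
      = (\<integral>\<^sup>+e. (\<Prod>i<Suc n. F (x + (\<Sum>j\<le>i. e j))) \<partial>distr (exp_measure \<Otimes>\<^sub>M S) S (\<lambda>(s, \<omega>). case_nat s \<omega>))"
    unfolding avoidance_def PiM_iter ..
  also have "\<dots> = (\<integral>\<^sup>+p. (\<Prod>i<Suc n. F (x + (\<Sum>j\<le>i. case_nat (fst p) (snd p) j))) \<partial>(exp_measure \<Otimes>\<^sub>M S))"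
    by (subst nn_integral_distr) (simp_all add: split_beta')
  also have "\<dots> = (\<integral>\<^sup>+p. F (x + fst p) * (\<Prod>i<n. F ((x + fst p) + (\<Sum>j\<le>i. snd p j))) \<partial>(exp_measure \<Otimes>\<^sub>M S))"
    by (simp add: prod.lessThan_Suc_shift sum.atMost_Suc_shift add.assoc del: prod.lessThan_Suc sum.atMost_Suc)
  also have "\<dots> = (\<integral>\<^sup>+s. \<integral>\<^sup>+e. F (x + s) * (\<Prod>i<n. F ((x + s) + (\<Sum>j\<le>i. e j))) \<partial>S \<partial>exp_measure)"
    by (subst P.nn_integral_fst[symmetric]) simp_all
  also have "\<dots> = (\<integral>\<^sup>+s. F (x + s) * avoidance F n (x + s) \<partial>exp_measure)"
    unfolding avoidance_def by (intro nn_integral_cong nn_integral_cmult) measurable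
  finally show ?thesis .
qed

lemma AE_exp_measure_pos: "AE s in exp_measure. 0 < s"
  using AE_lborel_singleton[of "0 :: real"]
  by (subst AE_density) (auto simp: exponential_density_def elim: eventually_mono)

text \<open>For n = 0 the avoidance probability is 1, which lies above the fixed point, and the
  recursion is monotone. The gap is supported below \<open>K\<close>, and it survives a further step
  only if that waiting time is below \<open>K\<close>, so each step contributes a factor 1 - exp (-
  K).\<close>

lemma avoidance_bounds:
  assumes S: "finite S" and q: "sum q S = 1" "\<And>v. v \<in> S \<Longrightarrow> 0 \<le> q v"
    and K: "\<And>v. v \<in> S \<Longrightarrow> v \<le> K" "0 \<le> K" and "0 \<le> x"
  shows "avoidance (\<lambda>u. ennreal (cdf_on S q u)) n x \<ge> ennreal (exp (- excess_on S q x))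
    \<and> avoidance (\<lambda>u. ennreal (cdf_on S q u)) n x
        \<le> ennreal (exp (- excess_on S q x)) + ennreal ((1 - exp (- K)) ^ n) * indicator {x. x < K} x"
  using \<open>0 \<le> x\<close>
proof (induction n arbitrary: x)
  interpret E: prob_space exp_measure by (rule prob_space_exp_measure)
  interpret sequence_space exp_measure
    by unfold_locales
  let ?F = "cdf_on S q" and ?B = "excess_on S q"
  have nonneg: "AE s in exp_measure. 0 \<le> s"
    using AE_exp_measure_pos by eventually_elim simp
  have F01: "0 \<le> ?F u" "?F u \<le> 1" for u
    unfolding cdf_on_def q(1)[symmetric] using q(2) by (auto intro!: sum_nonneg sum_mono)
  have B0: "0 \<le> ?B u" for u unfolding excess_on_def using q(2) by (auto intro!: sum_nonneg)
  have FK: "?B u = 0" if "u \<ge> K" for u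
    unfolding excess_on_def using K that by (intro sum.neutral) force
  {
    case 0
    have "ennreal (exp (- ?B x)) + 1 * indicator {x. x < K} x \<ge> 1"
      using FK[of x] by (cases "x < K") auto
    then show ?case using B0[of x] by (auto simp: avoidance_def P.emeasure_space_1 emeasure_space_1)
  next
    case (Suc n)
    let ?G = "avoidance (\<lambda>u. ennreal (?F u))" and ?d = "ennreal ((1 - exp (- K)) ^ n)"
    have rec: "?G (Suc n) x = (\<integral>\<^sup>+s. ennreal (?F (x + s)) * ?G n (x + s) \<partial>exp_measure)"
      by (rule avoidance_Suc) simp
    have "ennreal (exp (- ?B x)) = (\<integral>\<^sup>+s. ennreal (?F (x + s)) * ennreal (exp (- ?B (x + s))) \<partial>exp_measure)"
      by (subst exp_excess_fixpoint[OF S q, symmetric]) (simp_all add: ennreal_mult' F01)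
    also have "\<dots> \<le> ?G (Suc n) x"
      unfolding rec using nonneg
      by (intro nn_integral_mono_AE, eventually_elim) (use Suc in \<open>auto intro!: mult_left_mono\<close>)
    finally have 1: "ennreal (exp (- ?B x)) \<le> ?G (Suc n) x" .
    have "?G (Suc n) x \<le> (\<integral>\<^sup>+s. ennreal (?F (x + s) * exp (- ?B (x + s)))
        + ?d * (indicator {x. x < K} x * indicator {s. s < K} s) \<partial>exp_measure)"
      unfolding rec using nonneg
    proof (intro nn_integral_mono_AE, eventually_elim)
      fix s :: real assume s: "0 \<le> s"
      have "ennreal (?F (x + s)) * ?G n (x + s)
          \<le> ennreal (?F (x + s)) * (ennreal (exp (- ?B (x + s))) + ?d * indicator {x. x < K} (x + s))"
        using Suc s by (intro mult_left_mono) auto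
      also have "\<dots> = ennreal (?F (x + s) * exp (- ?B (x + s))) + ennreal (?F (x + s)) * (?d * indicator {x. x < K} (x + s))"
        by (simp add: distrib_left ennreal_mult' F01)
      \<comment> \<open>As x and s are nonnegative, x + s < K forces both of them below K;
        integrating the indicator in s then produces the next contraction factor.\<close>
      also have "ennreal (?F (x + s)) * (?d * indicator {x. x < K} (x + s)) \<le> 1 * (?d * (indicator {x. x < K} x * indicator {s. s < K} s))"
        using F01 s Suc.prems by (intro mult_mono) (auto simp: indicator_def)
      finally show "ennreal (?F (x + s)) * ?G n (x + s) \<le> ennreal (?F (x + s) * exp (- ?B (x + s)))
        + ?d * (indicator {x. x < K} x * indicator {s. s < K} s)" by (simp add: add_left_mono)
    qed
    also have "\<dots> = ennreal (exp (- ?B x)) + ?d * (indicator {x. x < K} x * ennreal (1 - exp (- K)))"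
      by (subst nn_integral_add)
        (simp_all add: exp_excess_fixpoint[OF S q] nn_integral_cmult exp_measure_less[OF K(2)] del: nn_integral_indicator)
    also have "\<dots> = ennreal (exp (- ?B x)) + ennreal ((1 - exp (- K)) ^ Suc n) * indicator {x. x < K} x"
      using K(2) by (simp add: ennreal_mult mult_ac)
    finally show ?case using 1 by simp
  }
qed

lemma avoidance_tendsto:
  assumes S: "finite S" and q: "sum q S = 1" "\<And>v. v \<in> S \<Longrightarrow> 0 \<le> q v" and x: "0 \<le> x"
  shows "(\<lambda>n. avoidance (\<lambda>u. ennreal (cdf_on S q u)) n x) \<longlonglongrightarrow> ennreal (exp (- excess_on S q x))"
proof -
  have "\<exists>K. \<forall>v\<in>insert 0 S. v \<le> K" using S by (meson Max_ge finite_insert)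
  then obtain K where K: "\<And>v. v \<in> S \<Longrightarrow> v \<le> K" "0 \<le> K" by blast
  note bounds = avoidance_bounds[OF S q K x]
  have "(\<lambda>n. (1 - exp (- K)) ^ n) \<longlonglongrightarrow> 0"
    using K(2) by (intro LIMSEQ_realpow_zero) auto
  then have "(\<lambda>n. ennreal ((1 - exp (- K)) ^ n)) \<longlonglongrightarrow> 0"
    using tendsto_ennrealI by fastforce
  then have "(\<lambda>n. ennreal (exp (- excess_on S q x)) + ennreal ((1 - exp (- K)) ^ n))
      \<longlonglongrightarrow> ennreal (exp (- excess_on S q x)) + 0"
    by (intro tendsto_add tendsto_const)
  then have lim: "(\<lambda>n. ennreal (exp (- excess_on S q x)) + ennreal ((1 - exp (- K)) ^ n))
      \<longlonglongrightarrow> ennreal (exp (- excess_on S q x))"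
    by (simp only: add_0_right)
  have "avoidance (\<lambda>u. ennreal (cdf_on S q u)) n x
      \<le> ennreal (exp (- excess_on S q x)) + ennreal ((1 - exp (- K)) ^ n)" for n
    using bounds[of n] by (cases "x < K") (auto intro: order_trans)
  then show ?thesis
    using bounds
    by (intro tendsto_sandwich[OF _ _ tendsto_const lim] always_eventually allI) blast+
qed

text \<open>The map exp (- a) on extended nonnegative numbers. The case \<open>\<top>\<close> is
  separate since \<open>enn2real \<top>\<close> is 0, which would give the value 1 instead of
  0.\<close>

definition exp_neg :: "ennreal \<Rightarrow> ennreal" where
  "exp_neg a = (if a = \<top> then 0 else ennreal (exp (- enn2real a)))"

lemma exp_neg_inject: "exp_neg a = exp_neg b \<longleftrightarrow> a = b"
  by (cases a; cases b) (auto simp: exp_neg_def)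

lemma exp_neg_tendsto:
  assumes "incseq a" and fin: "\<And>n. a n \<noteq> \<top>"
  shows "(\<lambda>n. exp_neg (a n)) \<longlonglongrightarrow> exp_neg (SUP n. a n)"
proof (cases "(SUP n. a n) = \<top>")
  case False
  have "a \<longlonglongrightarrow> (SUP n. a n)" by (rule LIMSEQ_SUP[OF assms(1)])
  then have "a \<longlonglongrightarrow> ennreal (enn2real (SUP n. a n))" using False by (simp only: ennreal_enn2real_if if_False)
  then have "(\<lambda>n. ennreal (exp (- enn2real (a n)))) \<longlonglongrightarrow> ennreal (exp (- enn2real (SUP n. a n)))"
    by (intro tendsto_ennrealI tendsto_intros tendsto_enn2real) auto
  then show ?thesis unfolding exp_neg_def using False fin by (simp only: if_False)
next
  case True
  have "a \<longlonglongrightarrow> \<top>" using LIMSEQ_SUP[OF assms(1)] True by simp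
  have "filterlim (\<lambda>n. enn2real (a n)) at_top sequentially"
    unfolding filterlim_at_top_gt[where c=0]
  proof safe
    fix Z :: real assume "0 < Z"
    have "eventually (\<lambda>n. ennreal Z < a n) sequentially"
      using \<open>a \<longlonglongrightarrow> \<top>\<close> by (rule order_tendstoD) simp
    then show "eventually (\<lambda>n. Z \<le> enn2real (a n)) sequentially"
    proof eventually_elim
      case (elim n)
      then show ?case using fin[of n] \<open>0 < Z\<close> by (cases "a n") (auto simp: ennreal_less_iff)
    qed
  qed
  then have "(\<lambda>n. exp (- enn2real (a n))) \<longlonglongrightarrow> 0"
    by (intro filterlim_compose[OF exp_at_bot] filterlim_compose[OF filterlim_uminus_at_bot_at_top])
  then have "(\<lambda>n. ennreal (exp (- enn2real (a n)))) \<longlonglongrightarrow> 0"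
    using tendsto_ennrealI by fastforce
  then show ?thesis using True fin by (simp add: exp_neg_def)
qed

section \<open>The avoidance event on the space of arrivals and marks\<close>

lemma AE_arrival_pos:
  "AE e in PiM (UNIV :: nat set) (\<lambda>_. exp_measure). \<forall>i. 0 < e i"
  unfolding AE_all_countable
  by (intro allI AE_PiM_component prob_space_exp_measure AE_exp_measure_pos) simp

lemma measurable_arrival[measurable]:
  "(\<lambda>e. \<Sum>j\<le>i. e j) \<in> borel_measurable (PiM (UNIV :: nat set) (\<lambda>_. exp_measure))"
proof (rule borel_measurable_sum)
  fix j :: nat
  have "(\<lambda>e. e j) \<in> PiM UNIV (\<lambda>_. exp_measure) \<rightarrow>\<^sub>M exp_measure"
    by (rule measurable_component_singleton) simp
  then show "(\<lambda>e. e j) \<in> borel_measurable (PiM UNIV (\<lambda>_. exp_measure))" by simp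
qed

lemma sets_mark_le_arrival:
  assumes V: "V \<in> borel_measurable Q"
  shows "{p \<in> space (PiM (UNIV :: nat set) (\<lambda>_. exp_measure) \<Otimes>\<^sub>M PiM (UNIV :: nat set) (\<lambda>_. Q)).
      V (snd p i) \<le> ennreal (\<Sum>j\<le>i. fst p j)}
    \<in> sets (PiM (UNIV :: nat set) (\<lambda>_. exp_measure) \<Otimes>\<^sub>M PiM (UNIV :: nat set) (\<lambda>_. Q))"
proof (rule borel_measurable_le)
  show "(\<lambda>p. V (snd p i)) \<in> borel_measurable (PiM (UNIV :: nat set) (\<lambda>_. exp_measure) \<Otimes>\<^sub>M PiM UNIV (\<lambda>_. Q))"
  proof (rule measurable_compose[OF _ V])
    show "(\<lambda>p. snd p i) \<in> PiM (UNIV :: nat set) (\<lambda>_. exp_measure) \<Otimes>\<^sub>M PiM UNIV (\<lambda>_. Q) \<rightarrow>\<^sub>M Q"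
      by (rule measurable_compose[OF measurable_snd measurable_component_singleton]) simp
  qed
  show "(\<lambda>p. ennreal (\<Sum>j\<le>i. fst p j)) \<in> borel_measurable (PiM UNIV (\<lambda>_. exp_measure) \<Otimes>\<^sub>M PiM (UNIV :: nat set) (\<lambda>_. Q))"
    using measurable_compose[OF measurable_compose[OF measurable_fst measurable_arrival] measurable_ennreal] .
qed

text \<open>The inequality is not strict, to match the closed event that a maximum does not exceed
  its thresholds.\<close>

definition arrivals_dominate ::
    "'a measure \<Rightarrow> ('a \<Rightarrow> ennreal) \<Rightarrow> ((nat \<Rightarrow> real) \<times> (nat \<Rightarrow> 'a)) set" where
  "arrivals_dominate Q V =
     {p \<in> space (PiM UNIV (\<lambda>_. exp_measure) \<Otimes>\<^sub>M PiM UNIV (\<lambda>_. Q)).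
        \<forall>i. V (snd p i) \<le> ennreal (\<Sum>j\<le>i. fst p j)}"

lemma sets_arrivals_dominate[measurable]:
  assumes "V \<in> borel_measurable Q"
  shows "arrivals_dominate Q V \<in> sets (PiM UNIV (\<lambda>_. exp_measure) \<Otimes>\<^sub>M PiM UNIV (\<lambda>_. Q))"
  unfolding arrivals_dominate_def
  by (intro sets.sets_Collect_countable_All sets_mark_le_arrival assms)

text \<open>The event is the decreasing limit of the events for the first n marks. Given the
  arrivals the marks are independent, so each of these has the avoidance probability started at 0;
  in the limit the excess at 0 of a nonnegative mark is its mean.\<close>

lemma emeasure_arrivals_dominate_simple:
  assumes "prob_space Q" and V: "simple_function Q V" and top: "\<And>x. V x < \<top>"
  shows "emeasure (PiM UNIV (\<lambda>_. exp_measure) \<Otimes>\<^sub>M PiM UNIV (\<lambda>_. Q)) (arrivals_dominate Q V)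
       = exp_neg (\<integral>\<^sup>+x. V x \<partial>Q)"
proof -
  interpret Q: prob_space Q by fact
  interpret E: prob_space exp_measure by (rule prob_space_exp_measure)
  interpret ES: sequence_space exp_measure by unfold_locales
  interpret QS: sequence_space Q by unfold_locales
  let ?P = "PiM (UNIV :: nat set) (\<lambda>_. exp_measure) \<Otimes>\<^sub>M PiM (UNIV :: nat set) (\<lambda>_. Q)"
  interpret PP: pair_prob_space "PiM (UNIV :: nat set) (\<lambda>_. exp_measure)" "PiM (UNIV :: nat set) (\<lambda>_. Q)"
    by unfold_locales
  have V'[measurable]: "V \<in> borel_measurable Q" using V by (rule borel_measurable_simple_function)
  define S where "S = enn2real ` V ` space Q"
  define q where "q v = measure Q {x \<in> space Q. V x = ennreal v}" for v
  have S: "finite S" using V by (simp add: S_def simple_functionD)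
  have S0: "0 \<le> v" if "v \<in> S" for v using that by (auto simp: S_def)
  have q0: "0 \<le> q v" for v by (simp add: q_def)
  have SV: "enn2real (V x) \<in> S" "V x = ennreal (enn2real (V x))" if "x \<in> space Q" for x
    using that top[of x] by (auto simp: S_def)
  have union: "measure Q (\<Union>v\<in>T. {x \<in> space Q. V x = ennreal v}) = sum q T" if "T \<subseteq> S" for T
    unfolding q_def using that S S0
    by (intro Q.finite_measure_finite_Union)
       (auto intro: finite_subset simp: disjoint_family_on_def subset_eq ennreal_inj)
  have "(\<Union>v\<in>S. {x \<in> space Q. V x = ennreal v}) = space Q"
    using SV by blast
  then have q1: "sum q S = 1" using union[of S] by (simp add: Q.prob_space)
  \<comment> \<open>For negative \<open>u\<close> the two sides can differ, because
    \<open>ennreal u\<close> is then 0. The arrival times are almost surely positive, so nonnegative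
    \<open>u\<close> are all that the product formula meets.\<close>
  have F: "emeasure Q {x \<in> space Q. V x \<le> ennreal u} = ennreal (cdf_on S q u)" if "0 \<le> u" for u
  proof -
    have "{x \<in> space Q. V x \<le> ennreal u} = (\<Union>v\<in>{v \<in> S. v \<le> u}. {x \<in> space Q. V x = ennreal v})"
    proof (intro set_eqI iffI)
      fix x assume x: "x \<in> {x \<in> space Q. V x \<le> ennreal u}"
      then have "enn2real (V x) \<le> u" using top[of x] that
        by (metis (no_types, lifting) SV(2) ennreal_le_iff mem_Collect_eq)
      then show "x \<in> (\<Union>v\<in>{v \<in> S. v \<le> u}. {x \<in> space Q. V x = ennreal v})"
        using SV x by blast
    qed (auto intro: ennreal_leI)
    moreover have "sum q {v \<in> S. v \<le> u} = cdf_on S q u"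
      unfolding cdf_on_def using S by (rule sum.inter_filter)
    ultimately show ?thesis using union[of "{v \<in> S. v \<le> u}"] by (simp add: Q.emeasure_eq_measure)
  qed
  let ?A = "\<lambda>n. {p \<in> space ?P. \<forall>i<n. V (snd p i) \<le> ennreal (\<Sum>j\<le>i. fst p j)}"
  have A: "?A n \<in> sets ?P" for n
  proof -
    have "{p \<in> space ?P. \<forall>i\<in>{..<n}. V (snd p i) \<le> ennreal (\<Sum>j\<le>i. fst p j)} \<in> sets ?P"
      by (intro sets.sets_Collect_finite_All sets_mark_le_arrival V') simp
    then show ?thesis by (simp only: lessThan_iff Ball_def)
  qed
  have "emeasure ?P (?A n) = avoidance (\<lambda>u. ennreal (cdf_on S q u)) n 0" for n
  proof -
    have "emeasure ?P (?A n)
        = (\<integral>\<^sup>+e. emeasure QS.S (Pair e -` ?A n) \<partial>ES.S)"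
      using A by (rule QS.P.emeasure_pair_measure_alt)
    also have "\<dots> = (\<integral>\<^sup>+e. (\<Prod>i<n. ennreal (cdf_on S q (0 + (\<Sum>j\<le>i. e j)))) \<partial>ES.S)"
      using AE_arrival_pos
    proof (intro nn_integral_cong_AE, eventually_elim)
      fix e :: "nat \<Rightarrow> real" assume "\<forall>i. 0 < e i"
      then have e: "\<forall>i. 0 \<le> e i" by (simp add: less_imp_le)
      have "Pair e -` ?A n = {z \<in> space QS.S. \<forall>i\<in>{..<n}. z i \<in> {x \<in> space Q. V x \<le> ennreal (\<Sum>j\<le>i. e j)}}"
        by (auto simp: space_pair_measure space_PiM)
      then have "emeasure QS.S (Pair e -` ?A n) = (\<Prod>i<n. emeasure Q {x \<in> space Q. V x \<le> ennreal (\<Sum>j\<le>i. e j)})"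
        by (subst QS.emeasure_PiM_Collect[symmetric]) simp_all
      also have "\<dots> = (\<Prod>i<n. ennreal (cdf_on S q (0 + (\<Sum>j\<le>i. e j))))"
        using e by (intro prod.cong) (auto simp: F sum_nonneg)
      finally show "emeasure QS.S (Pair e -` ?A n) = (\<Prod>i<n. ennreal (cdf_on S q (0 + (\<Sum>j\<le>i. e j))))" .
    qed
    finally show ?thesis unfolding avoidance_def .
  qed
  then have lim1: "(\<lambda>n. emeasure ?P (?A n)) \<longlonglongrightarrow> ennreal (exp (- excess_on S q 0))"
    using avoidance_tendsto[OF S q1 q0, of 0] by simp
  have lim2: "(\<lambda>n. emeasure ?P (?A n)) \<longlonglongrightarrow> emeasure ?P (\<Inter>n. ?A n)"
  proof (rule Lim_emeasure_decseq)
    show "range ?A \<subseteq> sets ?P" using A by blast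
    show "decseq ?A"
      unfolding decseq_def by (intro allI impI Collect_mono) (metis order_less_le_trans)
    show "emeasure ?P (?A n) \<noteq> \<infinity>" for n using PP.P.emeasure_finite by simp
  qed
  have "(\<Inter>n. ?A n) = arrivals_dominate Q V"
  proof (intro set_eqI iffI)
    fix p assume "p \<in> (\<Inter>n. ?A n)"
    then have p: "p \<in> ?A (Suc i)" for i by (rule INT_D) simp
    have "V (snd p i) \<le> ennreal (\<Sum>j\<le>i. fst p j)" for i using p[of i] lessI by blast
    then show "p \<in> arrivals_dominate Q V" unfolding arrivals_dominate_def using p by blast
  next
    fix p assume "p \<in> arrivals_dominate Q V"
    then show "p \<in> (\<Inter>n. ?A n)" unfolding arrivals_dominate_def by blast
  qed
  with LIMSEQ_unique[OF lim1 lim2]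
  have "emeasure ?P (arrivals_dominate Q V) = ennreal (exp (- excess_on S q 0))" by simp
  moreover have "(\<integral>\<^sup>+x. V x \<partial>Q) = ennreal (excess_on S q 0)"
  proof -
    have inj: "inj_on enn2real (V ` space Q)"
      using SV(2) by (intro inj_on_inverseI[where g=ennreal]) auto
    have "(\<integral>\<^sup>+x. V x \<partial>Q) = (\<Sum>v\<in>V ` space Q. v * emeasure Q (V -` {v} \<inter> space Q))"
      using V by (simp add: nn_integral_eq_simple_integral simple_integral_def)
    also have "\<dots> = (\<Sum>v\<in>V ` space Q. ennreal (q (enn2real v) * max 0 (enn2real v - 0)))"
    proof (rule sum.cong)
      fix v assume "v \<in> V ` space Q"
      then have v: "ennreal (enn2real v) = v" using SV(2) by auto
      moreover have "V -` {v} \<inter> space Q = {x \<in> space Q. V x = ennreal (enn2real v)}"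
        unfolding v by auto
      ultimately show "v * emeasure Q (V -` {v} \<inter> space Q) = ennreal (q (enn2real v) * max 0 (enn2real v - 0))"
        using q0 by (simp add: q_def Q.emeasure_eq_measure ennreal_mult mult.commute max_def)
    qed simp
    also have "\<dots> = ennreal (excess_on S q 0)"
      unfolding excess_on_def S_def using q0 inj by (simp add: sum_ennreal sum.reindex)
    finally show ?thesis .
  qed
  moreover have "0 \<le> excess_on S q 0" unfolding excess_on_def using q0 by (auto intro!: sum_nonneg)
  ultimately show ?thesis by (simp add: exp_neg_def)
qed

text \<open>A supremum stays below a bound iff all its terms do, so an increasing simple
  approximation of \<open>V\<close> makes the events decrease to the one for \<open>V\<close>. Both
  sides are continuous along it, also when the integral of \<open>V\<close> is infinite and the
  probability is 0.\<close>

theorem emeasure_arrivals_dominate: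
  assumes "prob_space Q" and V: "V \<in> borel_measurable Q"
  shows "emeasure (PiM UNIV (\<lambda>_. exp_measure) \<Otimes>\<^sub>M PiM UNIV (\<lambda>_. Q)) (arrivals_dominate Q V)
       = exp_neg (\<integral>\<^sup>+x. V x \<partial>Q)"
proof -
  interpret Q: prob_space Q by fact
  interpret E: prob_space exp_measure by (rule prob_space_exp_measure)
  interpret ES: sequence_space exp_measure by unfold_locales
  interpret QS: sequence_space Q by unfold_locales
  let ?P = "PiM (UNIV :: nat set) (\<lambda>_. exp_measure) \<Otimes>\<^sub>M PiM (UNIV :: nat set) (\<lambda>_. Q)"
  interpret PP: pair_prob_space "PiM (UNIV :: nat set) (\<lambda>_. exp_measure)" "PiM (UNIV :: nat set) (\<lambda>_. Q)"
    by unfold_locales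
  obtain U where U: "\<And>i. simple_function Q (U i)" "incseq U" "\<And>i x. U i x < \<top>" "\<And>x. (SUP i. U i x) = V x"
    using borel_measurable_implies_simple_function_sequence'[OF V] by metis
  have Um: "U i \<in> borel_measurable Q" for i using U(1) by (rule borel_measurable_simple_function)
  have mono: "U i x \<le> U j x" if "i \<le> j" for i j x using U(2) that by (auto simp: incseq_def le_fun_def)
  have INT: "arrivals_dominate Q V = (\<Inter>n. arrivals_dominate Q (U n))"
    unfolding arrivals_dominate_def U(4)[symmetric] by (auto simp: SUP_le_iff)
  have lim1: "(\<lambda>n. emeasure ?P (arrivals_dominate Q (U n))) \<longlonglongrightarrow> emeasure ?P (\<Inter>n. arrivals_dominate Q (U n))"
  proof (rule Lim_emeasure_decseq)
    show "decseq (\<lambda>n. arrivals_dominate Q (U n))"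
      unfolding arrivals_dominate_def decseq_def
      by (intro allI impI Collect_mono) (meson mono order_trans)
    show "range (\<lambda>n. arrivals_dominate Q (U n)) \<subseteq> sets ?P"
      by (intro image_subsetI sets_arrivals_dominate Um)
    show "emeasure ?P (arrivals_dominate Q (U n)) \<noteq> \<infinity>" for n using PP.P.emeasure_finite by simp
  qed
  have eq: "emeasure ?P (arrivals_dominate Q (U n)) = exp_neg (\<integral>\<^sup>+x. U n x \<partial>Q)" for n
    by (rule emeasure_arrivals_dominate_simple[OF assms(1) U(1) U(3)])
  have lim2: "(\<lambda>n. exp_neg (\<integral>\<^sup>+x. U n x \<partial>Q)) \<longlonglongrightarrow> exp_neg (SUP n. \<integral>\<^sup>+x. U n x \<partial>Q)"
  proof (rule exp_neg_tendsto)
    show "incseq (\<lambda>n. \<integral>\<^sup>+x. U n x \<partial>Q)"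
      using mono by (auto simp: incseq_def intro!: nn_integral_mono)
    fix n
    have Utop: "U n x \<noteq> \<top>" "\<top> \<noteq> U n x" for x using U(3)[of n x] by auto
    have "integral\<^sup>S Q (U n) < \<top>"
      unfolding simple_integral_def using U(1)[of n] Utop
      by (intro iffD2[OF ennreal_sum_less_top])
        (auto simp: ennreal_mult_eq_top_iff Q.emeasure_finite less_top[symmetric] simple_functionD)
    then show "(\<integral>\<^sup>+x. U n x \<partial>Q) \<noteq> \<top>" using U(1) by (simp add: nn_integral_eq_simple_integral)
  qed
  have "(SUP n. \<integral>\<^sup>+x. U n x \<partial>Q) = (\<integral>\<^sup>+x. V x \<partial>Q)"
    unfolding U(4)[symmetric] by (rule nn_integral_monotone_convergence_SUP[symmetric]) (use U Um in auto)
  with LIMSEQ_unique[OF lim1[unfolded eq] lim2] show ?thesis by (simp only: INT)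
qed

section \<open>Laws of max-stable processes\<close>

lemma countable_rational_points: "countable (rational_points :: (real ^ 'p) set)"
proof -
  have "(rational_points :: (real ^ 'p) set) \<subseteq> (\<lambda>g. \<chi> i. g i) ` (PiE UNIV (\<lambda>_. \<rat>))"
  proof
    fix t :: "real ^ 'p" assume "t \<in> rational_points"
    then have "t = (\<chi> i. (\<lambda>i. t $ i) i)" "(\<lambda>i. t $ i) \<in> PiE UNIV (\<lambda>_. \<rat>)"
      by (auto simp: rational_points_def)
    then show "t \<in> (\<lambda>g. \<chi> i. g i) ` (PiE UNIV (\<lambda>_. \<rat>))" by (rule image_eqI)
  qed
  then show ?thesis
    by (rule countable_subset) (intro countable_image countable_PiE countable_rat; simp)
qed

lemma rational_points_nonempty: "rational_points \<noteq> {}"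
  unfolding rational_points_def by (auto intro!: exI[of _ 0])

lemma rational_points_dense:
  fixes t :: "real ^ 'p"
  obtains r :: "nat \<Rightarrow> real ^ 'p" where "\<And>n. r n \<in> rational_points" "r \<longlonglongrightarrow> t"
proof
  let ?r = "\<lambda>n :: nat. (\<chi> i. of_int \<lfloor>real (Suc n) * t $ i\<rfloor> / real (Suc n)) :: real ^ 'p"
  show "?r n \<in> rational_points" for n unfolding rational_points_def by simp
  show "?r \<longlonglongrightarrow> t"
  proof (rule vec_tendstoI)
    fix i
    have bound: "norm (?r n $ i - t $ i) \<le> 1 / real (Suc n)" for n
    proof -
      have "\<bar>of_int \<lfloor>real (Suc n) * t $ i\<rfloor> - real (Suc n) * t $ i\<bar> \<le> 1" by linarith
      then have "\<bar>(of_int \<lfloor>real (Suc n) * t $ i\<rfloor> - real (Suc n) * t $ i) / real (Suc n)\<bar> \<le> 1 / real (Suc n)"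
        by (simp add: abs_divide divide_right_mono del: of_nat_Suc)
      then show ?thesis by (simp add: diff_divide_distrib)
    qed
    have "(\<lambda>n. ?r n $ i - t $ i) \<longlonglongrightarrow> 0"
      by (rule Lim_null_comparison[OF always_eventually[rule_format, OF bound] LIMSEQ_Suc[OF lim_1_over_n]])
    then show "(\<lambda>n. ?r n $ i) \<longlonglongrightarrow> t $ i" by (simp only: LIM_zero_iff)
  qed
qed

lemma space_path_space: "space path_space = paths"
  unfolding path_space_def by (rule space_measure_of) auto

lemma sets_path_space:
  "sets path_space = sigma_sets paths {{f \<in> paths. f t \<in> B} | t B. t \<in> rational_points \<and> B \<in> sets borel}"
  unfolding path_space_def by (rule sets_measure_of) auto

lemma measurable_path_spaceI:
  fixes g :: "'a \<Rightarrow> real ^ 'p \<Rightarrow> real ^ 'd"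
  assumes "\<And>\<omega>. \<omega> \<in> space M \<Longrightarrow> g \<omega> \<in> paths"
    and "\<And>t. t \<in> rational_points \<Longrightarrow> (\<lambda>\<omega>. g \<omega> t) \<in> borel_measurable M"
  shows "g \<in> M \<rightarrow>\<^sub>M path_space"
  unfolding path_space_def
proof (rule measurable_measure_of)
  show "g \<in> space M \<rightarrow> paths" using assms(1) by auto
  fix y :: "(real ^ 'p \<Rightarrow> real ^ 'd) set" assume "y \<in> {{f \<in> paths. f t \<in> B} | t B. t \<in> rational_points \<and> B \<in> sets borel}"
  then obtain t B where y: "y = {f \<in> paths. f t \<in> B}" "t \<in> rational_points" "B \<in> sets borel" by blast
  have "g -` y \<inter> space M = (\<lambda>\<omega>. g \<omega> t) -` B \<inter> space M" unfolding y using assms(1) by auto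
  then show "g -` y \<inter> space M \<in> sets M" using measurable_sets[OF assms(2) y(3)] y(2) by simp
qed auto

text \<open>The generators involve rational \<open>t\<close> only; any other evaluation is a
  pointwise limit of rational ones by continuity of the paths.\<close>

lemma measurable_path_eval:
  fixes t :: "real ^ 'p"
  shows "(\<lambda>f. f t :: real ^ 'd) \<in> borel_measurable path_space"
proof -
  have rat: "(\<lambda>f. f s :: real ^ 'd) \<in> borel_measurable path_space" if s: "s \<in> rational_points" for s :: "real ^ 'p"
  proof (rule measurableI)
    fix B :: "(real ^ 'd) set" assume "B \<in> sets borel"
    then have "{f \<in> paths. f s \<in> B} \<in> sets path_space"
      unfolding sets_path_space using s by (intro sigma_sets.Basic) auto
    moreover have "(\<lambda>f. f s) -` B \<inter> space path_space = {f \<in> paths. f s \<in> B}"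
      unfolding space_path_space by auto
    ultimately show "(\<lambda>f. f s) -` B \<inter> space path_space \<in> sets path_space" by simp
  qed simp
  obtain r :: "nat \<Rightarrow> real ^ 'p" where r: "\<And>n. r n \<in> rational_points" "r \<longlonglongrightarrow> t"
    using rational_points_dense[of t] by blast
  show ?thesis
  proof (rule borel_measurable_LIMSEQ_metric[where f="\<lambda>n f. f (r n)"])
    show "(\<lambda>f. f (r n) :: real ^ 'd) \<in> borel_measurable path_space" for n using rat r(1) by blast
    fix f :: "real ^ 'p \<Rightarrow> real ^ 'd" assume "f \<in> space path_space"
    then have "continuous_on UNIV f" by (simp add: space_path_space paths_def)
    then show "(\<lambda>n. f (r n)) \<longlonglongrightarrow> f t"
      by (rule continuous_on_tendsto_compose[OF _ r(2)]) auto
  qed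
qed

lemma measurable_path_coord:
  "(\<lambda>f. f t $ k) \<in> borel_measurable (path_space :: (real ^ 'p \<Rightarrow> real ^ 'd) measure)"
  by (rule measurable_compose[OF measurable_path_eval]) (intro borel_measurable_continuous_onI continuous_intros)

lemma paths_nonneg: "f \<in> paths \<Longrightarrow> 0 \<le> f t $ k"
  by (simp add: paths_def)

lemma paths_scale:
  assumes "f \<in> paths" "0 \<le> c" shows "(\<lambda>t. c *\<^sub>R f t) \<in> paths"
  using assms by (auto simp: paths_def intro!: continuous_intros)

lemma measurable_path_scale:
  assumes c: "c \<in> borel_measurable M" "\<And>\<omega>. \<omega> \<in> space M \<Longrightarrow> 0 \<le> c \<omega>" and g: "g \<in> M \<rightarrow>\<^sub>M path_space"
  shows "(\<lambda>\<omega> t. c \<omega> *\<^sub>R g \<omega> t) \<in> M \<rightarrow>\<^sub>M path_space"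
proof (rule measurable_path_spaceI)
  show "(\<lambda>t. c \<omega> *\<^sub>R g \<omega> t) \<in> paths" if "\<omega> \<in> space M" for \<omega>
    using measurable_space[OF g that] c(2)[OF that] by (simp add: space_path_space paths_scale)
  show "(\<lambda>\<omega>. c \<omega> *\<^sub>R g \<omega> t) \<in> borel_measurable M" for t
    using c(1) measurable_compose[OF g measurable_path_eval] by (intro borel_measurable_scaleR)
qed

text \<open>A finite family \<open>J\<close> of constraints \<open>((t, k), x)\<close>: \<open>level \<alpha> J f \<le> s\<close> says that the path
  \<open>f / s powr (1 / \<alpha>)\<close> satisfies \<open>f t $ k \<le> x\<close> for all of them. A coordinate may occur repeatedly,
  so that families can be joined.\<close>

definition level ::
    "real \<Rightarrow> (((real ^ 'p) \<times> 'd) \<times> real) set \<Rightarrow> (real ^ 'p \<Rightarrow> real ^ 'd) \<Rightarrow> ennreal" where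
  "level \<alpha> J f = (SUP ((t, k), x)\<in>J. ennreal ((f t $ k / x) powr \<alpha>))"

definition constraints :: "(((real ^ 'p) \<times> 'd) \<times> real) set \<Rightarrow> bool" where
  "constraints J \<longleftrightarrow> finite J \<and> (\<forall>(c, x) \<in> J. 0 < x)"

lemma measurable_level:
  assumes "constraints J" shows "level \<alpha> J \<in> borel_measurable path_space"
  unfolding level_def using assms
  by (intro borel_measurable_SUP)
    (auto simp: constraints_def countable_finite split_beta' intro!: measurable_compose[OF _ measurable_ennreal]
      powr_real_measurable borel_measurable_divide measurable_path_coord)

lemma level_homogeneous:
  assumes J: "constraints J" and "0 < c" and f: "f \<in> paths"
  shows "level \<alpha> J (\<lambda>t. c *\<^sub>R f t) = ennreal (c powr \<alpha>) * level \<alpha> J f"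
proof -
  have "ennreal ((c *\<^sub>R f t $ k / x) powr \<alpha>) = ennreal (c powr \<alpha>) * ennreal ((f t $ k / x) powr \<alpha>)"
    if "((t, k), x) \<in> J" for t k x
  proof -
    have "0 < x" using that J by (auto simp: constraints_def)
    then have "(c * (f t $ k / x)) powr \<alpha> = c powr \<alpha> * (f t $ k / x) powr \<alpha>"
      using paths_nonneg[OF f] \<open>0 < c\<close> by (intro powr_mult)
    then show ?thesis using \<open>0 < c\<close> by (simp add: ennreal_mult)
  qed
  then have "level \<alpha> J (\<lambda>t. c *\<^sub>R f t) = (SUP ((t, k), x)\<in>J. ennreal (c powr \<alpha>) * ennreal ((f t $ k / x) powr \<alpha>))"
    unfolding level_def by (intro SUP_cong) auto
  then show ?thesis unfolding level_def by (simp add: SUP_mult_left_ennreal split_beta')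
qed

lemma level_in_homogeneous_maps:
  "constraints J \<Longrightarrow> level \<alpha> J \<in> homogeneous_maps \<alpha>"
  unfolding homogeneous_maps_def by (simp add: measurable_level level_homogeneous)

lemma level_zero: "0 < \<alpha> \<Longrightarrow> (\<And>t. f t = 0) \<Longrightarrow> level \<alpha> J f = 0"
  by (auto simp: level_def SUP_eq_iff bot_ennreal intro!: SUP_eq_const order_antisym SUP_least)

section \<open>Joint distribution functions of the maximum\<close>

lemma measurable_max_map:
  assumes Q: "sets Q = sets (path_space :: (real ^ 'p \<Rightarrow> real ^ 'd) measure)"
  shows "(\<lambda>(e, z) (t, k). SUP i. ennreal ((\<Sum>j\<le>i. e j) powr (- 1 / \<alpha>) * z i t $ k))
    \<in> PiM (UNIV :: nat set) (\<lambda>_. exp_measure) \<Otimes>\<^sub>M PiM (UNIV :: nat set) (\<lambda>_. Q) \<rightarrow>\<^sub>M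
      PiM (UNIV :: ((real ^ 'p) \<times> 'd) set) (\<lambda>_. borel)"
  (is "_ \<in> ?P \<rightarrow>\<^sub>M _")
proof -
  have "(\<lambda>p. SUP i. ennreal ((\<Sum>j\<le>i. fst p j) powr (- 1 / \<alpha>) * snd p i t $ k)) \<in> borel_measurable ?P"
    for t :: "real ^ 'p" and k :: 'd
  proof (intro borel_measurable_SUP countableI_type measurable_compose[OF _ measurable_ennreal]
      borel_measurable_times powr_real_measurable borel_measurable_const)
    fix i :: nat
    show "(\<lambda>p. \<Sum>j\<le>i. fst p j) \<in> borel_measurable ?P"
      by (rule measurable_compose[OF measurable_fst measurable_arrival])
    have "(\<lambda>p. snd p i) \<in> ?P \<rightarrow>\<^sub>M Q"
      by (rule measurable_compose[OF measurable_snd measurable_component_singleton]) simp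
    then have "(\<lambda>p. snd p i) \<in> ?P \<rightarrow>\<^sub>M path_space" using Q measurable_cong_sets by blast
    then show "(\<lambda>p. snd p i t $ k) \<in> borel_measurable ?P"
      by (rule measurable_compose[OF _ measurable_path_coord])
  qed
  then have "(\<lambda>p c. SUP i. ennreal ((\<Sum>j\<le>i. fst p j) powr (- 1 / \<alpha>) * snd p i (fst c) $ snd c))
      \<in> ?P \<rightarrow>\<^sub>M PiM (UNIV :: ((real ^ 'p) \<times> 'd) set) (\<lambda>_. borel)"
    by (intro measurable_PiM_single') auto
  then show ?thesis by (simp add: split_beta')
qed

text \<open>Rewrites a bound on one term of the maximum as a comparison of a mark with its arrival
  time \<open>s\<close>; this is how the exponent \<alpha> enters \<open>level\<close>.\<close>

lemma powr_inverse_le_iff: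
  fixes s z x :: real
  assumes "0 < s" "0 \<le> z" "0 < x" "0 < \<alpha>"
  shows "s powr (- 1 / \<alpha>) * z \<le> x \<longleftrightarrow> (z / x) powr \<alpha> \<le> s"
proof -
  have "s powr (- 1 / \<alpha>) * z \<le> x \<longleftrightarrow> z / x \<le> s powr (1 / \<alpha>)"
    using assms by (simp add: powr_minus_divide field_simps)
  also have "\<dots> \<longleftrightarrow> (z / x) powr \<alpha> \<le> (s powr (1 / \<alpha>)) powr \<alpha>"
    using assms powr_mono2[of \<alpha> "z / x" "s powr (1 / \<alpha>)"] powr_less_mono2[of \<alpha> "s powr (1 / \<alpha>)" "z / x"]
    by (auto simp: not_le[symmetric])
  finally show ?thesis using assms by (simp add: powr_powr)
qed

definition lower_set :: "('c \<times> real) set \<Rightarrow> ('c \<Rightarrow> ennreal) set" where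
  "lower_set J = {y. \<forall>(c, x)\<in>J. y c \<le> ennreal x}"

lemma lower_set_in_sets:
  assumes "finite J" shows "lower_set J \<in> sets (PiM UNIV (\<lambda>_. borel))"
proof -
  have "{y \<in> space (PiM UNIV (\<lambda>_. borel)). \<forall>j\<in>J. y (fst j) \<le> ennreal (snd j)} \<in> sets (PiM (UNIV :: 'a set) (\<lambda>_. borel))"
    using assms by (intro sets.sets_Collect_finite_All borel_measurable_le measurable_component_singleton) auto
  then show ?thesis by (simp add: lower_set_def space_PiM split_beta')
qed

text \<open>The maximum obeys all constraints iff every arrival time is at least the level of its
  path, so this is the avoidance formula with \<open>level \<alpha> J\<close> as mark. The two
  events are compared almost surely, because the powers can be inverted only at positive arrival
  times.\<close>

lemma emeasure_max_stable_law:
  fixes Q :: "(real ^ 'p \<Rightarrow> real ^ 'd) measure"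
  assumes "0 < \<alpha>" and "prob_space Q" and Q: "sets Q = sets path_space" and J: "constraints J"
  shows "emeasure (max_stable_law \<alpha> Q) (lower_set J) = exp_neg (\<integral>\<^sup>+f. level \<alpha> J f \<partial>Q)"
proof -
  interpret Q: prob_space Q by fact
  interpret E: prob_space exp_measure by (rule prob_space_exp_measure)
  interpret ES: sequence_space exp_measure by unfold_locales
  interpret QS: sequence_space Q by unfold_locales
  let ?P = "PiM (UNIV :: nat set) (\<lambda>_. exp_measure) \<Otimes>\<^sub>M PiM (UNIV :: nat set) (\<lambda>_. Q)"
  interpret PP: pair_prob_space "PiM (UNIV :: nat set) (\<lambda>_. exp_measure)" "PiM (UNIV :: nat set) (\<lambda>_. Q)"
    by unfold_locales
  define \<phi> :: "(nat \<Rightarrow> real) \<times> (nat \<Rightarrow> real ^ 'p \<Rightarrow> real ^ 'd) \<Rightarrow> (real ^ 'p) \<times> 'd \<Rightarrow> ennreal"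
    where "\<phi> = (\<lambda>(e, z) (t, k). SUP i. ennreal ((\<Sum>j\<le>i. e j) powr (- 1 / \<alpha>) * z i t $ k))"
  have \<phi>: "\<phi> \<in> ?P \<rightarrow>\<^sub>M PiM UNIV (\<lambda>_. borel)" unfolding \<phi>_def by (rule measurable_max_map[OF Q])
  have L: "level \<alpha> J \<in> borel_measurable Q"
    using measurable_level[OF J] by (simp cong: measurable_cong_sets add: Q)
  have LS: "lower_set J \<in> sets (PiM UNIV (\<lambda>_. borel))"
    using J by (intro lower_set_in_sets) (simp add: constraints_def)
  \<comment> \<open>Positivity of the arrivals is known on the first factor; the marginal of the
    product carries it over to the pair.\<close>
  have "distr ?P (PiM UNIV (\<lambda>_. exp_measure)) fst = PiM UNIV (\<lambda>_. exp_measure)"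
    by (rule QS.P.distr_pair_fst)
  then have "AE e in distr ?P (PiM UNIV (\<lambda>_. exp_measure)) fst. \<forall>i. 0 < e i"
    using AE_arrival_pos by (simp only:)
  then have "AE p in ?P. \<forall>i. 0 < fst p i" by (rule AE_distrD[rotated]) simp
  then have "AE p in ?P. p \<in> \<phi> -` lower_set J \<inter> space ?P \<longleftrightarrow> p \<in> arrivals_dominate Q (level \<alpha> J)"
    using AE_space
  proof eventually_elim
    fix p assume p0: "\<forall>i. 0 < fst p i" and p: "p \<in> space ?P"
    have z: "snd p i \<in> paths" for i
      using p sets_eq_imp_space_eq[OF Q] by (auto simp: space_pair_measure space_PiM space_path_space PiE_iff)
    have s: "0 < (\<Sum>j\<le>i. fst p j)" for i using p0 by (intro sum_pos) auto
    have "p \<in> \<phi> -` lower_set J \<inter> space ?P \<longleftrightarrow> (\<forall>((t, k), x)\<in>J. \<forall>i.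
        ennreal ((\<Sum>j\<le>i. fst p j) powr (- 1 / \<alpha>) * snd p i t $ k) \<le> ennreal x)"
      using p by (auto simp: \<phi>_def lower_set_def SUP_le_iff split_beta')
    also have "\<dots> \<longleftrightarrow> (\<forall>((t, k), x)\<in>J. \<forall>i. ennreal ((snd p i t $ k / x) powr \<alpha>) \<le> ennreal (\<Sum>j\<le>i. fst p j))"
    proof (intro ball_cong refl, clarify, intro all_cong1)
      fix t k x i assume "((t, k), x) \<in> J"
      then have x: "0 < x" using J by (auto simp: constraints_def)
      show "ennreal ((\<Sum>j\<le>i. fst p j) powr (- 1 / \<alpha>) * snd p i t $ k) \<le> ennreal x
        \<longleftrightarrow> ennreal ((snd p i t $ k / x) powr \<alpha>) \<le> ennreal (\<Sum>j\<le>i. fst p j)"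
        using powr_inverse_le_iff[OF s paths_nonneg[OF z] x \<open>0 < \<alpha>\<close>, of i i t k] s[of i] x
        by (simp add: ennreal_le_iff)
    qed
    also have "\<dots> \<longleftrightarrow> p \<in> arrivals_dominate Q (level \<alpha> J)"
      using p by (auto simp: arrivals_dominate_def level_def SUP_le_iff split_beta')
    finally show "p \<in> \<phi> -` lower_set J \<inter> space ?P \<longleftrightarrow> p \<in> arrivals_dominate Q (level \<alpha> J)" .
  qed
  then have "emeasure ?P (\<phi> -` lower_set J \<inter> space ?P) = emeasure ?P (arrivals_dominate Q (level \<alpha> J))"
    by (rule emeasure_eq_AE) (use measurable_sets[OF \<phi> LS] sets_arrivals_dominate[OF L] in auto)
  then show ?thesis
    unfolding max_stable_law_def \<phi>_def[symmetric]
    by (simp only: emeasure_distr[OF \<phi> LS] emeasure_arrivals_dominate[OF \<open>prob_space Q\<close> L])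
qed

text \<open>The exponent can be recovered from the distribution function, since
  \<open>exp_neg\<close> is injective even at infinity.\<close>

lemma max_stable_law_eqD:
  fixes Q Q' :: "(real ^ 'p \<Rightarrow> real ^ 'd) measure"
  assumes "0 < \<alpha>" "prob_space Q" "sets Q = sets path_space" "prob_space Q'" "sets Q' = sets path_space"
    and "max_stable_law \<alpha> Q = max_stable_law \<alpha> Q'" and J: "constraints J"
  shows "(\<integral>\<^sup>+f. level \<alpha> J f \<partial>Q) = (\<integral>\<^sup>+f. level \<alpha> J f \<partial>Q')"
  using emeasure_max_stable_law[OF assms(1,2,3) J] emeasure_max_stable_law[OF assms(1,4,5) J] assms(6)
  by (simp add: exp_neg_inject)

text \<open>Thresholds are positive reals because \<open>level\<close> divides by them. A bound by
  any real r \<ge> 0, zero included, is the intersection of the bounds by r + 1 / (n + 1), and a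
  bound by \<open>\<top>\<close> is void.\<close>

lemma sets_PiM_ennreal_lower_sets:
  "sets (PiM (UNIV :: 'c set) (\<lambda>_. borel))
    = sigma_sets UNIV {lower_set J | J. finite J \<and> (\<forall>(c :: 'c, x)\<in>J. 0 < x)}"
  (is "_ = sigma_sets UNIV ?G")
proof (rule antisym)
  have G: "lower_set {(c, x)} \<in> ?G" if "0 < x" for c :: 'c and x using that by auto
  let ?S = "sigma UNIV ?G"
  have S: "sets ?S = sigma_sets UNIV ?G" "space ?S = UNIV" by auto
  have "(\<lambda>y. y c) \<in> borel_measurable ?S" for c
  proof (rule borel_measurableI_le)
    fix a :: ennreal
    have pos: "{y \<in> space ?S. y c \<le> ennreal x} \<in> sets ?S" if "0 < x" for x
      using G[OF that, of c] unfolding S by (auto simp: lower_set_def)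
    show "{y \<in> space ?S. y c \<le> a} \<in> sets ?S"
    proof (cases a)
      case (real r)
      have "{y \<in> space ?S. y c \<le> a} = (\<Inter>n. {y \<in> space ?S. y c \<le> ennreal (r + 1 / real (Suc n))})"
      proof (intro set_eqI iffI)
        fix y assume y: "y \<in> (\<Inter>n. {y \<in> space ?S. y c \<le> ennreal (r + 1 / real (Suc n))})"
        have "(\<lambda>n. ennreal (r + 1 / real (Suc n))) \<longlonglongrightarrow> ennreal (r + 0)"
          by (intro tendsto_ennrealI tendsto_intros LIMSEQ_Suc[OF lim_1_over_n])
        then have "y c \<le> ennreal (r + 0)"
          by (rule LIMSEQ_le_const) (use y in auto)
        then show "y \<in> {y \<in> space ?S. y c \<le> a}" using real by (simp add: S)
      qed (use real in \<open>auto intro: order_trans ennreal_leI\<close>)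
      also have "\<dots> \<in> sets ?S"
        using real sets.top[of ?S] by (intro sets.countable_INT'' pos) (auto simp: add_nonneg_pos S)
      finally show ?thesis .
    next
      case top
      then have "{y \<in> space ?S. y c \<le> a} = space ?S" by auto
      then show ?thesis by (simp only: sets.top)
    qed
  qed
  then have "(\<lambda>y c. y c) \<in> ?S \<rightarrow>\<^sub>M PiM UNIV (\<lambda>_. borel)"
    by (intro measurable_PiM_single') auto
  from measurable_sets[OF this] show "sets (PiM (UNIV :: 'c set) (\<lambda>_. borel)) \<subseteq> sigma_sets UNIV ?G"
    unfolding S by auto
next
  have "?G \<subseteq> sets (PiM (UNIV :: 'c set) (\<lambda>_. borel))" using lower_set_in_sets by blast
  then show "sigma_sets UNIV ?G \<subseteq> sets (PiM (UNIV :: 'c set) (\<lambda>_. borel))"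
    using sets.sigma_sets_subset[of ?G "PiM (UNIV :: 'c set) (\<lambda>_. borel)"] by (simp add: space_PiM)
qed

text \<open>Intersecting lower sets means joining families of constraints, so they form a generator
  stable under intersection. The empty family gives the whole space, whose level is 0 and whose mass
  is therefore finite.\<close>

lemma max_stable_law_eqI:
  fixes Q Q' :: "(real ^ 'p \<Rightarrow> real ^ 'd) measure"
  assumes "0 < \<alpha>" "prob_space Q" "sets Q = sets path_space" "prob_space Q'" "sets Q' = sets path_space"
    and eq: "\<And>J. constraints J \<Longrightarrow> (\<integral>\<^sup>+f. level \<alpha> J f \<partial>Q) = (\<integral>\<^sup>+f. level \<alpha> J f \<partial>Q')"
  shows "max_stable_law \<alpha> Q = max_stable_law \<alpha> Q'"
proof -
  let ?G = "{lower_set J | J :: (((real ^ 'p) \<times> 'd) \<times> real) set. constraints J}"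
  have sets: "sets (max_stable_law \<alpha> R) = sigma_sets UNIV ?G" for R :: "(real ^ 'p \<Rightarrow> real ^ 'd) measure"
    unfolding max_stable_law_def constraints_def by (simp add: sets_PiM_ennreal_lower_sets)
  note law = emeasure_max_stable_law[OF assms(1,2,3)] emeasure_max_stable_law[OF assms(1,4,5)]
  have UNIV: "(UNIV :: ((real ^ 'p) \<times> 'd \<Rightarrow> ennreal) set) = lower_set {}" by (auto simp: lower_set_def)
  have empty: "constraints ({} :: (((real ^ 'p) \<times> 'd) \<times> real) set)" by (simp add: constraints_def)
  show ?thesis
  proof (rule measure_eqI_generator_eq[OF _ _ _ sets sets])
    show "Int_stable ?G"
    proof (rule Int_stableI)
      fix A B assume "A \<in> ?G" "B \<in> ?G"
      then obtain J K :: "(((real ^ 'p) \<times> 'd) \<times> real) set" where "A = lower_set J" "B = lower_set K" "constraints J" "constraints K"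
        by blast
      then have "A \<inter> B = lower_set (J \<union> K)" "constraints (J \<union> K)"
        by (simp_all add: lower_set_def constraints_def ball_Un Collect_conj_eq)
      then show "A \<inter> B \<in> ?G" by blast
    qed
    show "emeasure (max_stable_law \<alpha> Q) X = emeasure (max_stable_law \<alpha> Q') X" if "X \<in> ?G" for X
      using that eq by (auto simp: law)
    show "range (\<lambda>_ :: nat. UNIV) \<subseteq> ?G" using UNIV empty by blast
    show "emeasure (max_stable_law \<alpha> Q) UNIV \<noteq> \<infinity>"
      unfolding UNIV by (simp add: law(1)[OF empty] exp_neg_def)
  qed auto
qed

section \<open>Homogeneous functionals\<close>

text \<open>On the set where n is the first index with a positive weight, H equals
  \<open>w n\<close> times H / \<open>w n\<close>. The quotient is 0-homogeneous because both parts
  scale by the same power, and the set itself is invariant under scaling. It serves twice, with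
  powers of coordinates and with powers of norms as weights.\<close>

lemma homogeneous_integral_eq:
  fixes Q Q' :: "(real ^ 'p \<Rightarrow> real ^ 'd) measure" and w :: "nat \<Rightarrow> (real ^ 'p \<Rightarrow> real ^ 'd) \<Rightarrow> real"
  assumes Q: "sets Q = sets path_space" and Q': "sets Q' = sets path_space"
    and w: "\<And>n. w n \<in> borel_measurable path_space" "\<And>n f. f \<in> paths \<Longrightarrow> 0 \<le> w n f"
    and hom: "\<And>n c f. f \<in> paths \<Longrightarrow> 0 < c \<Longrightarrow> w n (\<lambda>t. c *\<^sub>R f t) = c powr \<alpha> * w n f"
    and eq: "\<And>n G. G \<in> homogeneous_maps 0 \<Longrightarrow>
      (\<integral>\<^sup>+f. ennreal (w n f) * G f \<partial>Q) = (\<integral>\<^sup>+f. ennreal (w n f) * G f \<partial>Q')"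
    and H: "H \<in> homogeneous_maps \<alpha>"
    and ae: "AE f in Q. H f = 0 \<or> (\<exists>n. 0 < w n f)" "AE f in Q'. H f = 0 \<or> (\<exists>n. 0 < w n f)"
  shows "(\<integral>\<^sup>+f. H f \<partial>Q) = (\<integral>\<^sup>+f. H f \<partial>Q')"
proof -
  \<comment> \<open>Requiring the earlier weights to vanish makes the supports disjoint, so at each
    path at most one term of the series is nonzero.\<close>
  define G where "G n f = (if 0 < w n f \<and> (\<forall>m<n. w m f = 0) then ennreal (inverse (w n f)) * H f else 0)" for n f
  have Hm: "H \<in> borel_measurable path_space" using H by (simp add: homogeneous_maps_def)
  note [measurable] = Hm w(1)
  have Gm: "G n \<in> borel_measurable path_space" for n unfolding G_def by measurable
  have G: "G n \<in> homogeneous_maps 0" for n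
  proof -
    have "G n (\<lambda>t. c *\<^sub>R f t) = G n f" if c: "0 < c" and f: "f \<in> paths" for c f
    proof -
      have "ennreal (inverse (c powr \<alpha> * w n f)) * (ennreal (c powr \<alpha>) * H f) = ennreal (inverse (w n f)) * H f"
        if "0 < w n f"
        using that c by (simp add: mult.assoc[symmetric] ennreal_mult[symmetric] field_simps)
      then show ?thesis
        unfolding G_def using c f H by (auto simp: hom zero_less_mult_iff homogeneous_maps_def)
    qed
    then show ?thesis using Gm by (simp add: homogeneous_maps_def)
  qed
  have split: "(\<integral>\<^sup>+f. H f \<partial>R) = (\<Sum>n. \<integral>\<^sup>+f. ennreal (w n f) * G n f \<partial>R)"
    if R: "sets R = sets path_space" and ae: "AE f in R. H f = 0 \<or> (\<exists>n. 0 < w n f)"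
    for R :: "(real ^ 'p \<Rightarrow> real ^ 'd) measure"
  proof -
    have "AE f in R. H f = (\<Sum>n. ennreal (w n f) * G n f)"
      using ae AE_space
    proof eventually_elim
      fix f assume f: "H f = 0 \<or> (\<exists>n. 0 < w n f)" "f \<in> space R"
      then have pf: "f \<in> paths" using sets_eq_imp_space_eq[OF R] by (simp add: space_path_space)
      show "H f = (\<Sum>n. ennreal (w n f) * G n f)"
      proof (cases "\<exists>n. 0 < w n f")
        case False
        then show ?thesis using f(1) by (simp add: G_def)
      next
        case True
        define N where "N = (LEAST n. 0 < w n f)"
        have N: "0 < w N f" unfolding N_def using True by (rule LeastI_ex)
        have least: "w m f = 0" if "m < N" for m
          using not_less_Least[of m "\<lambda>n. 0 < w n f"] that w(2)[OF pf, of m] by (force simp: N_def)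
        have "ennreal (w n f) * G n f = (if n = N then H f else 0)" for n
        proof (cases "n = N")
          case True
          have "ennreal (w N f) * (ennreal (inverse (w N f)) * H f) = H f"
            using N by (simp add: mult.assoc[symmetric] ennreal_mult[symmetric])
          then show ?thesis using True N least by (simp add: G_def)
        next
          case False
          then have "n < N \<or> N < n" by auto
          then show ?thesis using False N least by (auto simp: G_def)
        qed
        then have "(\<lambda>n. ennreal (w n f) * G n f) = (\<lambda>n. if n = N then H f else 0)" by blast
        then show ?thesis using sums_unique[OF sums_single[of N "\<lambda>_. H f"]] by simp
      qed
    qed
    then have "(\<integral>\<^sup>+f. H f \<partial>R) = (\<integral>\<^sup>+f. (\<Sum>n. ennreal (w n f) * G n f) \<partial>R)" by (rule nn_integral_cong_AE)
    also have "\<dots> = (\<Sum>n. \<integral>\<^sup>+f. ennreal (w n f) * G n f \<partial>R)"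
    proof (rule nn_integral_suminf)
      fix n
      have "(\<lambda>f. ennreal (w n f) * G n f) \<in> borel_measurable path_space" using Gm by measurable
      then show "(\<lambda>f. ennreal (w n f) * G n f) \<in> borel_measurable R" by (simp cong: measurable_cong_sets add: R)
    qed
    finally show ?thesis .
  qed
  show ?thesis using split[OF Q ae(1)] split[OF Q' ae(2)] eq[OF G] by simp
qed

section \<open>Measures on the path space determined by coordinate bounds\<close>

definition path_lower_set :: "(((real ^ 'p) \<times> 'd) \<times> real) set \<Rightarrow> (real ^ 'p \<Rightarrow> real ^ 'd) set" where
  "path_lower_set J = {f \<in> paths. \<forall>((t, k), x)\<in>J. f t $ k \<le> x}"

lemma path_lower_set_in_sets: "finite J \<Longrightarrow> path_lower_set J \<in> sets path_space"
proof -
  assume J: "finite J"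
  have "{f \<in> space path_space. \<forall>j\<in>J. f (fst (fst j)) $ snd (fst j) \<le> snd j} \<in> sets path_space"
    by (intro sets.sets_Collect_finite_All borel_measurable_le measurable_path_coord borel_measurable_const J)
  then show ?thesis by (simp add: path_lower_set_def space_path_space split_beta')
qed

text \<open>Positive thresholds suffice because coordinates are nonnegative: a negative bound gives
  the empty set, and the bound 0 is the intersection of the bounds 1 / (n + 1). Measurability of all
  coordinates gives that of the vector-valued evaluations.\<close>

lemma sets_path_space_lower_sets:
  "sets (path_space :: (real ^ 'p \<Rightarrow> real ^ 'd) measure)
    = sigma_sets paths {path_lower_set J | J. constraints J}"
  (is "_ = sigma_sets paths ?G")
proof (rule antisym)
  let ?S = "sigma paths ?G"
  have sub: "?G \<subseteq> Pow paths" by (auto simp: path_lower_set_def)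
  have S: "sets ?S = sigma_sets paths ?G" "space ?S = paths" using sub by auto
  have "(\<lambda>f. f) \<in> ?S \<rightarrow>\<^sub>M path_space"
  proof (rule measurable_path_spaceI)
    fix t :: "real ^ 'p"
    have coord: "(\<lambda>f. f t $ k) \<in> borel_measurable ?S" for k :: 'd
    proof (rule borel_measurableI_le)
      fix a :: real
      have pos: "{f \<in> space ?S. f t $ k \<le> x} \<in> sets ?S" if "0 < x" for x
      proof -
        have "constraints {((t, k), x)}" using that by (simp add: constraints_def)
        moreover have "{f \<in> space ?S. f t $ k \<le> x} = path_lower_set {((t, k), x)}"
          unfolding S by (auto simp: path_lower_set_def)
        ultimately show ?thesis unfolding S by (intro sigma_sets.Basic) blast
      qed
      consider "0 < a" | "a = 0" | "a < 0" by linarith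
      then show "{f \<in> space ?S. f t $ k \<le> a} \<in> sets ?S"
      proof cases
        case 2
        have "{f \<in> space ?S. f t $ k \<le> a} = (\<Inter>n. {f \<in> space ?S. f t $ k \<le> 1 / real (Suc n)})"
        proof (intro set_eqI iffI)
          fix f assume f: "f \<in> (\<Inter>n. {f \<in> space ?S. f t $ k \<le> 1 / real (Suc n)})"
          have "f t $ k \<le> 0"
            by (rule LIMSEQ_le_const[OF LIMSEQ_Suc[OF lim_1_over_n]]) (use f in auto)
          then show "f \<in> {f \<in> space ?S. f t $ k \<le> a}" using f 2 by auto
        qed (use 2 in \<open>auto intro: order_trans\<close>)
        also have "\<dots> \<in> sets ?S"
          using pos by (intro sets.countable_INT') auto
        finally show ?thesis .
      next
        case 3
        then have "{f \<in> space ?S. f t $ k \<le> a} = {}"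
          unfolding S by (force dest: paths_nonneg[of _ t k])
        then show ?thesis by (simp only: sets.empty_sets)
      qed (use pos in simp)
    qed
    have "(\<lambda>f. f t \<bullet> b) \<in> borel_measurable ?S" if b: "b \<in> Basis" for b :: "real ^ 'd"
    proof -
      obtain k where k: "b = axis k 1" using b unfolding Basis_vec_def by auto
      have "f t \<bullet> b = f t $ k" for f :: "real ^ 'p \<Rightarrow> real ^ 'd" unfolding k by (simp add: inner_axis)
      then show ?thesis using coord[of k] by (simp only:)
    qed
    then show "(\<lambda>f. f t :: real ^ 'd) \<in> borel_measurable ?S"
      by (rule iffD2[OF borel_measurable_euclidean_space, OF ballI])
  qed (simp add: S)
  from measurable_sets[OF this] have "(\<lambda>f. f) -` A \<inter> paths \<in> sigma_sets paths ?G"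
    if "A \<in> sets path_space" for A using that unfolding S by blast
  moreover have "A \<subseteq> paths" if "A \<in> sets path_space" for A :: "(real ^ 'p \<Rightarrow> real ^ 'd) set"
    using sets.sets_into_space[OF that] by (simp add: space_path_space)
  ultimately show "sets path_space \<subseteq> sigma_sets paths ?G" by (auto simp: Int_absorb2)
next
  have "?G \<subseteq> sets path_space" using path_lower_set_in_sets by (auto simp: constraints_def)
  then show "sigma_sets paths ?G \<subseteq> sets path_space"
    using sets.sigma_sets_subset[of ?G path_space] by (simp add: space_path_space)
qed

text \<open>Formulated for finite measures, since it is applied to tilts by a coordinate, whose
  total mass is a moment of that coordinate and need not be 1.\<close>

lemma path_measure_eqI:
  fixes \<nu> \<nu>' :: "(real ^ 'p \<Rightarrow> real ^ 'd) measure"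
  assumes \<nu>: "sets \<nu> = sets path_space" and \<nu>': "sets \<nu>' = sets path_space"
    and eq: "\<And>J. constraints J \<Longrightarrow> emeasure \<nu> (path_lower_set J) = emeasure \<nu>' (path_lower_set J)"
    and fin: "emeasure \<nu> paths \<noteq> \<infinity>"
  shows "\<nu> = \<nu>'"
proof (rule measure_eqI_generator_eq)
  let ?G = "{path_lower_set J | J :: (((real ^ 'p) \<times> 'd) \<times> real) set. constraints J}"
  show "Int_stable ?G"
  proof (rule Int_stableI)
    fix A B assume "A \<in> ?G" "B \<in> ?G"
    then obtain J K :: "(((real ^ 'p) \<times> 'd) \<times> real) set"
      where "A = path_lower_set J" "B = path_lower_set K" "constraints J" "constraints K" by blast
    then have "A \<inter> B = path_lower_set (J \<union> K)" "constraints (J \<union> K)"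
      by (simp_all add: path_lower_set_def constraints_def ball_Un Collect_conj_eq Int_ac)
    then show "A \<inter> B \<in> ?G" by blast
  qed
  show "emeasure \<nu> X = emeasure \<nu>' X" if "X \<in> ?G" for X using that eq by blast
  show "?G \<subseteq> Pow paths" by (auto simp: path_lower_set_def)
  show "sets \<nu> = sigma_sets paths ?G" "sets \<nu>' = sigma_sets paths ?G"
    using \<nu> \<nu>' by (simp_all add: sets_path_space_lower_sets)
  have "paths = path_lower_set {}" "constraints {}" by (simp_all add: path_lower_set_def constraints_def)
  then show "range (\<lambda>_ :: nat. paths) \<subseteq> ?G" by blast
qed (use fin in auto)

text \<open>The right derivative of \<open>\<integral> max (y * a) b\<close> at \<open>y = 1\<close> is \<open>\<integral> a * indicator {b \<le> a}\<close>.\<close>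

lemma nn_integral_indicator_eq_of_max:
  fixes a b :: "'a \<Rightarrow> real"
  assumes sets: "sets Q' = sets Q"
    and [measurable]: "a \<in> borel_measurable Q" "b \<in> borel_measurable Q"
    and nonneg: "\<And>f. f \<in> space Q \<Longrightarrow> 0 \<le> a f" "\<And>f. f \<in> space Q \<Longrightarrow> 0 \<le> b f"
    and eq: "\<And>y. 1 \<le> y \<Longrightarrow> (\<integral>\<^sup>+f. ennreal (max (y * a f) (b f)) \<partial>Q) = (\<integral>\<^sup>+f. ennreal (max (y * a f) (b f)) \<partial>Q')"
    and fin: "(\<integral>\<^sup>+f. ennreal (max (a f) (b f)) \<partial>Q) < \<top>"
  shows "(\<integral>\<^sup>+f. ennreal (a f) * indicator {f. b f \<le> a f} f \<partial>Q) = (\<integral>\<^sup>+f. ennreal (a f) * indicator {f. b f \<le> a f} f \<partial>Q')"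
proof -
  define h where "h n = 1 / real (Suc n)" for n
  have h: "0 < h n" for n by (simp add: h_def)
  \<comment> \<open>The right difference quotients at 1. They lie between 0 and \<open>a\<close>,
    which is the integrable dominating function in the limit.\<close>
  define d where "d n f = (max ((1 + h n) * a f) (b f) - max (a f) (b f)) / h n" for n f
  have [measurable]: "d n \<in> borel_measurable Q" for n unfolding d_def by measurable
  have space: "space Q' = space Q" by (rule sets_eq_imp_space_eq[OF sets])
  have meas': "g \<in> borel_measurable Q'" if "g \<in> borel_measurable Q" for g :: "'a \<Rightarrow> ennreal"
    using that by (simp cong: measurable_cong_sets add: sets)
  have d0: "0 \<le> d n f" if "f \<in> space Q" for n f
  proof -
    have "a f \<le> (1 + h n) * a f" using nonneg(1)[OF that] h[of n] by (simp add: algebra_simps)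
    then have "max (a f) (b f) \<le> max ((1 + h n) * a f) (b f)" by linarith
    then show ?thesis using h[of n] by (simp add: d_def)
  qed
  have da: "d n f \<le> a f" if "f \<in> space Q" for n f
  proof -
    have "0 \<le> h n * a f" using nonneg(1)[OF that] h[of n] by simp
    then have "max ((1 + h n) * a f) (b f) - max (a f) (b f) \<le> h n * a f"
      by (simp add: distrib_right max_def)
    then show ?thesis using h[of n] by (simp add: d_def divide_le_eq mult.commute)
  qed
  \<comment> \<open>Written as a sum because extended nonnegative integrals cannot be subtracted
    freely; the common finite term is cancelled after integration.\<close>
  have split: "ennreal (max ((1 + h n) * a f) (b f)) = ennreal (max (a f) (b f)) + ennreal (h n) * ennreal (d n f)"
    if "f \<in> space Q" for n f
  proof -
    have "max ((1 + h n) * a f) (b f) = max (a f) (b f) + h n * d n f" using h[of n] by (simp add: d_def)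
    then show ?thesis using d0[OF that, of n] h[of n] nonneg[OF that]
      by (simp add: ennreal_plus[symmetric] ennreal_mult[symmetric] del: ennreal_plus)
  qed
  have sum: "(\<integral>\<^sup>+f. ennreal (max ((1 + h n) * a f) (b f)) \<partial>R)
      = (\<integral>\<^sup>+f. ennreal (max (a f) (b f)) \<partial>R) + ennreal (h n) * (\<integral>\<^sup>+f. ennreal (d n f) \<partial>R)"
    if R: "sets R = sets Q" for R n
  proof -
    have [measurable]: "a \<in> borel_measurable R" "b \<in> borel_measurable R" "d n \<in> borel_measurable R"
      by (simp_all cong: measurable_cong_sets add: R)
    have "(\<integral>\<^sup>+f. ennreal (max ((1 + h n) * a f) (b f)) \<partial>R)
        = (\<integral>\<^sup>+f. ennreal (max (a f) (b f)) + ennreal (h n) * ennreal (d n f) \<partial>R)"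
      using split sets_eq_imp_space_eq[OF R] by (intro nn_integral_cong) auto
    then show ?thesis by (simp add: nn_integral_add nn_integral_cmult)
  qed
  have deq: "(\<integral>\<^sup>+f. ennreal (d n f) \<partial>Q) = (\<integral>\<^sup>+f. ennreal (d n f) \<partial>Q')" for n
  proof -
    have "ennreal (h n) * (\<integral>\<^sup>+f. ennreal (d n f) \<partial>Q) = ennreal (h n) * (\<integral>\<^sup>+f. ennreal (d n f) \<partial>Q')"
      using sum[OF refl, of n] sum[OF sets, of n] eq[of "1 + h n"] eq[of 1] h[of n] fin
      by (auto simp: ennreal_add_left_cancel)
    then show ?thesis using h[of n] by (simp add: ennreal_mult_cancel_left)
  qed
  \<comment> \<open>If b \<le> a, every quotient is exactly a, also at equality; if a < b, the
    quotients are eventually 0. A right derivative thus yields the non-strict indicator.\<close>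
  have lim: "(\<lambda>n. ennreal (d n f)) \<longlonglongrightarrow> ennreal (a f) * indicator {f. b f \<le> a f} f" if f: "f \<in> space Q" for f
  proof (cases "b f \<le> a f")
    case True
    have "d n f = a f" for n
    proof -
      have "b f \<le> (1 + h n) * a f" using True nonneg(1)[OF f] h[of n] by (simp add: distrib_right add_increasing2)
      then show ?thesis using True h[of n] by (simp add: d_def max_def distrib_right)
    qed
    then show ?thesis using True by simp
  next
    case False
    have "(\<lambda>n. (1 + h n) * a f) \<longlonglongrightarrow> (1 + 0) * a f"
      unfolding h_def by (intro tendsto_intros LIMSEQ_Suc[OF lim_1_over_n])
    then have "eventually (\<lambda>n. (1 + h n) * a f < b f) sequentially"
      using False by (intro order_tendstoD(2)) auto
    then have "eventually (\<lambda>n. ennreal (d n f) = 0) sequentially"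
      by eventually_elim (use False in \<open>simp add: d_def max_def\<close>)
    then show ?thesis using False by (simp add: tendsto_eventually)
  qed
  have conv: "(\<lambda>n. \<integral>\<^sup>+f. ennreal (d n f) \<partial>R) \<longlonglongrightarrow> (\<integral>\<^sup>+f. ennreal (a f) * indicator {f. b f \<le> a f} f \<partial>R)"
    if R: "sets R = sets Q" and finR: "(\<integral>\<^sup>+f. ennreal (max (a f) (b f)) \<partial>R) < \<top>" for R
  proof (rule nn_integral_dominated_convergence[where w="\<lambda>f. ennreal (a f)"])
    have [measurable]: "a \<in> borel_measurable R" "b \<in> borel_measurable R" "d n \<in> borel_measurable R" for n
      by (simp_all cong: measurable_cong_sets add: R)
    have sp: "space R = space Q" by (rule sets_eq_imp_space_eq[OF R])
    show "(\<lambda>f. ennreal (d n f)) \<in> borel_measurable R" for n by measurable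
    show "(\<lambda>f. ennreal (a f) * indicator {f. b f \<le> a f} f) \<in> borel_measurable R" by measurable
    show "(\<lambda>f. ennreal (a f)) \<in> borel_measurable R" by measurable
    show "AE f in R. ennreal (d n f) \<le> ennreal (a f)" for n using da sp by (auto intro!: AE_I2 ennreal_leI)
    have "(\<integral>\<^sup>+f. ennreal (a f) \<partial>R) \<le> (\<integral>\<^sup>+f. ennreal (max (a f) (b f)) \<partial>R)"
      by (intro nn_integral_mono ennreal_leI) simp
    then show "(\<integral>\<^sup>+f. ennreal (a f) \<partial>R) < \<infinity>" using finR by simp
    show "AE f in R. (\<lambda>n. ennreal (d n f)) \<longlonglongrightarrow> ennreal (a f) * indicator {f. b f \<le> a f} f"
      using lim sp by auto
  qed
  have fin': "(\<integral>\<^sup>+f. ennreal (max (a f) (b f)) \<partial>Q') < \<top>" using fin eq[of 1] by simp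
  show ?thesis
    using LIMSEQ_unique[OF conv[OF refl fin, unfolded deq] conv[OF sets fin']] .
qed

section \<open>Moments of levels and tilted measures\<close>

lemma level_insert:
  "level \<alpha> (insert ((t, k), x) J) f = max (ennreal ((f t $ k / x) powr \<alpha>)) (level \<alpha> J f)"
  by (simp add: level_def sup_max)

lemma level_le_iff:
  "level \<alpha> J f \<le> s \<longleftrightarrow> (\<forall>((t, k), x)\<in>J. ennreal ((f t $ k / x) powr \<alpha>) \<le> s)"
  by (auto simp: level_def SUP_le_iff split_beta')

lemma level_le_sum:
  assumes "finite J"
  shows "level \<alpha> J f \<le> (\<Sum>((t, k), x)\<in>J. ennreal ((f t $ k / x) powr \<alpha>))"
  unfolding level_def using assms by (intro SUP_least) (auto intro!: member_le_sum simp: split_beta' simp del: sum_ennreal)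

lemma level_less_top: "constraints J \<Longrightarrow> level \<alpha> J f < \<top>"
  by (rule le_less_trans[OF level_le_sum]) (auto simp: constraints_def split_beta')

text \<open>A maximum of finitely many nonnegative terms is at most their sum, and the thresholds
  only scale the moments of the single coordinates.\<close>

lemma nn_integral_level_less_top:
  fixes Q :: "(real ^ 'p \<Rightarrow> real ^ 'd) measure"
  assumes Q: "sets Q = sets path_space" and J: "constraints J"
    and fin: "\<And>t k. (\<integral>\<^sup>+f. ennreal ((f t $ k) powr \<alpha>) \<partial>Q) < \<top>"
  shows "(\<integral>\<^sup>+f. level \<alpha> J f \<partial>Q) < \<top>"
proof -
  have meas: "(\<lambda>f. ennreal ((f t $ k / x) powr \<alpha>)) \<in> borel_measurable Q" for t k x
    unfolding measurable_cong_sets[OF Q refl]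
    by (intro measurable_compose[OF _ measurable_ennreal] powr_real_measurable borel_measurable_divide
        measurable_path_coord borel_measurable_const)
  have "(\<integral>\<^sup>+f. ennreal ((f t $ k / x) powr \<alpha>) \<partial>Q) < \<top>" if "((t, k), x) \<in> J" for t k x
  proof -
    have x: "0 < x" using that J by (auto simp: constraints_def)
    have "(\<integral>\<^sup>+f. ennreal ((f t $ k / x) powr \<alpha>) \<partial>Q)
        = (\<integral>\<^sup>+f. ennreal (inverse (x powr \<alpha>)) * ennreal ((f t $ k / 1) powr \<alpha>) \<partial>Q)"
    proof (intro nn_integral_cong)
      fix f assume "f \<in> space Q"
      then have f: "f \<in> paths" using sets_eq_imp_space_eq[OF Q] by (simp add: space_path_space)
      show "ennreal ((f t $ k / x) powr \<alpha>) = ennreal (inverse (x powr \<alpha>)) * ennreal ((f t $ k / 1) powr \<alpha>)"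
        using x by (simp add: ennreal_mult[symmetric] powr_divide field_simps)
    qed
    also have "\<dots> = ennreal (inverse (x powr \<alpha>)) * (\<integral>\<^sup>+f. ennreal ((f t $ k / 1) powr \<alpha>) \<partial>Q)"
      by (rule nn_integral_cmult[OF meas])
    also have "\<dots> < \<top>" using fin[of t k] by (simp add: ennreal_mult_less_top)
    finally show ?thesis .
  qed
  then have "(\<Sum>((t, k), x)\<in>J. \<integral>\<^sup>+f. ennreal ((f t $ k / x) powr \<alpha>) \<partial>Q) < \<top>"
    using J by (auto simp: constraints_def split_beta' less_top[symmetric])
  also have "(\<Sum>((t, k), x)\<in>J. \<integral>\<^sup>+f. ennreal ((f t $ k / x) powr \<alpha>) \<partial>Q)
      = (\<integral>\<^sup>+f. (\<Sum>((t, k), x)\<in>J. ennreal ((f t $ k / x) powr \<alpha>)) \<partial>Q)"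
    using meas by (simp add: nn_integral_sum split_beta' del: sum_ennreal)
  finally show ?thesis
    using J by (elim le_less_trans[rotated]) (auto simp: constraints_def intro!: nn_integral_mono level_le_sum)
qed

text \<open>The path is rescaled so that \<open>u\<close> becomes 1 and weighted by u^\<alpha>; the
  result has mass E u^\<alpha> and is left unnormalised. Paths with u = 0 are sent to the zero path
  but carry weight \<open>0 powr \<alpha> = 0\<close>. A coordinate as \<open>u\<close> serves to
  identify laws, a norm as \<open>u\<close> gives the tilted process.\<close>

definition tilt ::
    "real \<Rightarrow> ((real ^ 'p \<Rightarrow> real ^ 'd) \<Rightarrow> real) \<Rightarrow> (real ^ 'p \<Rightarrow> real ^ 'd) measure \<Rightarrow> (real ^ 'p \<Rightarrow> real ^ 'd) measure" where
  "tilt \<alpha> u Q = distr (density Q (\<lambda>f. ennreal (u f powr \<alpha>))) path_space (\<lambda>f t. inverse (u f) *\<^sub>R f t)"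

lemma nn_integral_tilt:
  fixes Q :: "(real ^ 'p \<Rightarrow> real ^ 'd) measure"
  assumes Q: "sets Q = sets path_space" and u: "u \<in> borel_measurable path_space" "\<And>f. f \<in> paths \<Longrightarrow> 0 \<le> u f"
    and G: "G \<in> borel_measurable path_space"
  shows "(\<integral>\<^sup>+f. G f \<partial>tilt \<alpha> u Q) = (\<integral>\<^sup>+f. ennreal (u f powr \<alpha>) * G (\<lambda>t. inverse (u f) *\<^sub>R f t) \<partial>Q)"
proof -
  have scale: "(\<lambda>f t. inverse (u f) *\<^sub>R f t) \<in> path_space \<rightarrow>\<^sub>M path_space"
    using u by (intro measurable_path_scale) (auto simp: space_path_space)
  then have scale': "(\<lambda>f t. inverse (u f) *\<^sub>R f t) \<in> density Q (\<lambda>f. ennreal (u f powr \<alpha>)) \<rightarrow>\<^sub>M path_space"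
    by (simp cong: measurable_cong_sets add: Q)
  have "(\<lambda>f. ennreal (u f powr \<alpha>)) \<in> borel_measurable Q"
    unfolding measurable_cong_sets[OF Q refl]
    by (intro measurable_compose[OF _ measurable_ennreal] powr_real_measurable u borel_measurable_const)
  moreover have "(\<lambda>f. G (\<lambda>t. inverse (u f) *\<^sub>R f t)) \<in> borel_measurable Q"
    unfolding measurable_cong_sets[OF Q refl] by (rule measurable_compose[OF scale G])
  ultimately have "(\<integral>\<^sup>+f. G (\<lambda>t. inverse (u f) *\<^sub>R f t) \<partial>density Q (\<lambda>f. ennreal (u f powr \<alpha>)))
      = (\<integral>\<^sup>+f. ennreal (u f powr \<alpha>) * G (\<lambda>t. inverse (u f) *\<^sub>R f t) \<partial>Q)"
    by (rule nn_integral_density)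
  moreover have "G \<in> borel_measurable (distr (density Q (\<lambda>f. ennreal (u f powr \<alpha>))) path_space (\<lambda>f t. inverse (u f) *\<^sub>R f t))"
    using G by (simp only: measurable_distr_eq1)
  ultimately show ?thesis
    unfolding tilt_def by (simp only: nn_integral_distr[OF scale'])
qed

text \<open>A 0-homogeneous map does not see the rescaling by \<open>inverse (u f)\<close>, and
  where \<open>u f = 0\<close> the weight removes the integrand.\<close>

lemma nn_integral_tilt_homogeneous:
  fixes Q :: "(real ^ 'p \<Rightarrow> real ^ 'd) measure"
  assumes Q: "sets Q = sets path_space" and u: "u \<in> borel_measurable path_space" "\<And>f. f \<in> paths \<Longrightarrow> 0 \<le> u f"
    and G: "G \<in> homogeneous_maps 0"
  shows "(\<integral>\<^sup>+f. G f \<partial>tilt \<alpha> u Q) = (\<integral>\<^sup>+f. ennreal (u f powr \<alpha>) * G f \<partial>Q)"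
proof -
  have Gm: "G \<in> borel_measurable path_space" using G by (simp add: homogeneous_maps_def)
  have "ennreal (u f powr \<alpha>) * G (\<lambda>t. inverse (u f) *\<^sub>R f t) = ennreal (u f powr \<alpha>) * G f" if "f \<in> space Q" for f
  proof (cases "u f = 0")
    case False
    have f: "f \<in> paths" using sets_eq_imp_space_eq[OF Q] that by (simp add: space_path_space)
    then have "0 < inverse (u f)" using False u(2)[OF f] by simp
    then have "G (\<lambda>t. inverse (u f) *\<^sub>R f t) = ennreal (inverse (u f) powr 0) * G f"
      using G f unfolding homogeneous_maps_def by blast
    then show ?thesis using \<open>0 < inverse (u f)\<close> by simp
  qed simp
  then have "(\<integral>\<^sup>+f. ennreal (u f powr \<alpha>) * G (\<lambda>t. inverse (u f) *\<^sub>R f t) \<partial>Q) = (\<integral>\<^sup>+f. ennreal (u f powr \<alpha>) * G f \<partial>Q)"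
    by (rule nn_integral_cong)
  with nn_integral_tilt[OF Q u Gm] show ?thesis by (rule trans)
qed

lemma sets_tilt: "sets (tilt \<alpha> u Q) = sets path_space"
  by (simp add: tilt_def)

text \<open>With a the power of the chosen coordinate and b the level of \<open>J\<close>, the
  rescaled path satisfies the constraints \<open>J\<close> iff b \<le> a. The integrals of max (y a)
  b are themselves levels, of \<open>J\<close> with one more constraint, so the derivative argument
  gives equal mass to every set of the generator.\<close>

lemma tilt_coordinate_eq:
  fixes Q Q' :: "(real ^ 'p \<Rightarrow> real ^ 'd) measure"
  assumes "0 < \<alpha>" and Q: "sets Q = sets path_space" and Q': "sets Q' = sets path_space"
    and eq: "\<And>J. constraints J \<Longrightarrow> (\<integral>\<^sup>+f. level \<alpha> J f \<partial>Q) = (\<integral>\<^sup>+f. level \<alpha> J f \<partial>Q')"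
    and fin: "\<And>t k. (\<integral>\<^sup>+f. ennreal ((f t $ k) powr \<alpha>) \<partial>Q) < \<top>"
  shows "tilt \<alpha> (\<lambda>f. f t $ k) Q = tilt \<alpha> (\<lambda>f. f t $ k) Q'"
proof (rule path_measure_eqI[OF sets_tilt sets_tilt])
  let ?u = "\<lambda>f :: real ^ 'p \<Rightarrow> real ^ 'd. f t $ k"
  fix J :: "(((real ^ 'p) \<times> 'd) \<times> real) set" assume J: "constraints J"
  define a where "a f = ?u f powr \<alpha>" for f
  define b where "b f = enn2real (level \<alpha> J f)" for f
  have b: "ennreal (b f) = level \<alpha> J f" for f using level_less_top[OF J] by (simp add: b_def)
  have a: "a \<in> borel_measurable path_space"
    unfolding a_def by (intro powr_real_measurable measurable_path_coord borel_measurable_const)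
  have bm: "b \<in> borel_measurable path_space"
    unfolding b_def by (rule measurable_compose[OF measurable_level[OF J] borel_measurable_enn2real]) simp
  \<comment> \<open>The threshold y^(-1/\<alpha>) is chosen so that its constraint contributes
    exactly y times \<open>a f\<close> to the level. Since a family may repeat a coordinate, it does
    not matter whether \<open>J\<close> already bounds this one.\<close>
  have ins: "constraints (insert ((t, k), y powr (- 1 / \<alpha>)) J)" if "1 \<le> y" for y
    using J that by (auto simp: constraints_def)
  have max: "ennreal (max (y * a f) (b f)) = level \<alpha> (insert ((t, k), y powr (- 1 / \<alpha>)) J) f"
    if "1 \<le> y" "f \<in> paths" for y f
  proof -
    have "(?u f / y powr (- 1 / \<alpha>)) powr \<alpha> = (?u f * y powr (1 / \<alpha>)) powr \<alpha>"
      using that by (simp add: powr_minus_divide)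
    also have "\<dots> = y * a f" using that \<open>0 < \<alpha>\<close> paths_nonneg by (simp add: powr_mult powr_powr a_def)
    finally show ?thesis
      by (simp only: level_insert b[symmetric] max_of_mono[OF monoI[of ennreal, OF ennreal_leI]])
  qed
  have max_int: "(\<integral>\<^sup>+f. ennreal (max (y * a f) (b f)) \<partial>R) = (\<integral>\<^sup>+f. level \<alpha> (insert ((t, k), y powr (- 1 / \<alpha>)) J) f \<partial>R)"
    if y: "1 \<le> y" and R: "sets R = sets path_space" for y R
    using max[OF y] sets_eq_imp_space_eq[OF R] by (intro nn_integral_cong) (simp add: space_path_space)
  have lower: "emeasure (tilt \<alpha> ?u R) (path_lower_set J) = (\<integral>\<^sup>+f. ennreal (a f) * indicator {f. b f \<le> a f} f \<partial>R)"
    if R: "sets R = sets path_space" for R :: "(real ^ 'p \<Rightarrow> real ^ 'd) measure"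
  proof -
    have L: "path_lower_set J \<in> sets path_space" using J by (intro path_lower_set_in_sets) (simp add: constraints_def)
    have "emeasure (tilt \<alpha> ?u R) (path_lower_set J) = (\<integral>\<^sup>+f. indicator (path_lower_set J) f \<partial>tilt \<alpha> ?u R)"
      using L by (simp add: sets_tilt)
    also have "\<dots> = (\<integral>\<^sup>+f. ennreal (?u f powr \<alpha>) * indicator (path_lower_set J) (\<lambda>t. inverse (?u f) *\<^sub>R f t) \<partial>R)"
      by (intro nn_integral_tilt R measurable_path_coord borel_measurable_indicator L paths_nonneg)
    also have "\<dots> = (\<integral>\<^sup>+f. ennreal (a f) * indicator {f. b f \<le> a f} f \<partial>R)"
    proof (rule nn_integral_cong)
      fix f assume "f \<in> space R"
      then have f: "f \<in> paths" using sets_eq_imp_space_eq[OF R] by (simp add: space_path_space)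
      have "(\<lambda>s. inverse (?u f) *\<^sub>R f s) \<in> path_lower_set J \<longleftrightarrow> b f \<le> a f" if u: "0 < ?u f"
      proof -
        have "b f \<le> a f \<longleftrightarrow> level \<alpha> J f \<le> ennreal (a f)"
          unfolding b[symmetric] by (rule ennreal_le_iff[symmetric]) (simp add: a_def)
        also have "\<dots> \<longleftrightarrow> (\<forall>((t', k'), x)\<in>J. (f t' $ k' / x) powr \<alpha> \<le> ?u f powr \<alpha>)"
          by (simp add: level_le_iff a_def)
        also have "\<dots> \<longleftrightarrow> (\<forall>((t', k'), x)\<in>J. inverse (?u f) * f t' $ k' \<le> x)"
        proof (intro ball_cong refl, clarify)
          fix t' k' x assume "((t', k'), x) \<in> J"
          then have x: "0 < x" using J by (auto simp: constraints_def)
          then have "(f t' $ k' / x) powr \<alpha> \<le> ?u f powr \<alpha> \<longleftrightarrow> f t' $ k' / x \<le> ?u f"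
            using u paths_nonneg[OF f, of t' k'] \<open>0 < \<alpha>\<close>
              powr_mono2[of \<alpha> "f t' $ k' / x" "?u f"] powr_less_mono2[of \<alpha> "?u f" "f t' $ k' / x"]
            by (auto simp: not_le[symmetric])
          also have "\<dots> \<longleftrightarrow> inverse (?u f) * f t' $ k' \<le> x" using u x by (simp add: field_simps)
          finally show "(f t' $ k' / x) powr \<alpha> \<le> ?u f powr \<alpha> \<longleftrightarrow> inverse (?u f) * f t' $ k' \<le> x" .
        qed
        finally show ?thesis
          using paths_scale[OF f, of "inverse (?u f)"] u by (simp add: path_lower_set_def)
      qed
      then show "ennreal (?u f powr \<alpha>) * indicator (path_lower_set J) (\<lambda>t. inverse (?u f) *\<^sub>R f t)
          = ennreal (a f) * indicator {f. b f \<le> a f} f"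
        using paths_nonneg[OF f, of t k] by (cases "?u f = 0") (auto simp: a_def indicator_def)
    qed
    finally show ?thesis .
  qed
  have "(\<integral>\<^sup>+f. ennreal (a f) * indicator {f. b f \<le> a f} f \<partial>Q) = (\<integral>\<^sup>+f. ennreal (a f) * indicator {f. b f \<le> a f} f \<partial>Q')"
  proof (rule nn_integral_indicator_eq_of_max)
    show "sets Q' = sets Q" by (simp add: Q Q')
    show "a \<in> borel_measurable Q" "b \<in> borel_measurable Q"
      using a bm unfolding measurable_cong_sets[OF Q refl] by blast+
    show "0 \<le> a f" "0 \<le> b f" for f by (simp_all add: a_def b_def)
    show "(\<integral>\<^sup>+f. ennreal (max (y * a f) (b f)) \<partial>Q) = (\<integral>\<^sup>+f. ennreal (max (y * a f) (b f)) \<partial>Q')"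
      if "1 \<le> y" for y unfolding max_int[OF that Q] max_int[OF that Q'] by (rule eq[OF ins[OF that]])
    show "(\<integral>\<^sup>+f. ennreal (max (a f) (b f)) \<partial>Q) < \<top>"
      using max_int[of 1, OF _ Q] nn_integral_level_less_top[OF Q ins[of 1] fin] by simp
  qed
  then show "emeasure (tilt \<alpha> ?u Q) (path_lower_set J) = emeasure (tilt \<alpha> ?u Q') (path_lower_set J)"
    unfolding lower[OF Q] lower[OF Q'] .
next
  have P: "paths \<in> sets (path_space :: (real ^ 'p \<Rightarrow> real ^ 'd) measure)" using sets.top[of path_space] by (simp add: space_path_space)
  have "emeasure (tilt \<alpha> (\<lambda>f. f t $ k) Q) paths = (\<integral>\<^sup>+f. indicator paths f \<partial>tilt \<alpha> (\<lambda>f. f t $ k) Q)"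
    using P by (simp add: sets_tilt)
  also have "\<dots> = (\<integral>\<^sup>+f. ennreal (f t $ k powr \<alpha>) * indicator paths (\<lambda>s. inverse (f t $ k) *\<^sub>R f s) \<partial>Q)"
    by (intro nn_integral_tilt Q measurable_path_coord borel_measurable_indicator P paths_nonneg)
  also have "\<dots> \<le> (\<integral>\<^sup>+f. ennreal (f t $ k powr \<alpha>) \<partial>Q)"
    by (intro nn_integral_mono) (auto simp: indicator_def)
  finally show "emeasure (tilt \<alpha> (\<lambda>f. f t $ k) Q) paths \<noteq> \<infinity>" using fin[of t k] by auto
qed

lemma coordinate_enumeration:
  obtains c :: "nat \<Rightarrow> (real ^ 'p) \<times> ('d :: finite)" where "range c = rational_points \<times> UNIV"
proof -
  have "rational_points \<times> (UNIV :: 'd set) \<noteq> {}" using rational_points_nonempty by auto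
  moreover have "countable (rational_points \<times> (UNIV :: 'd set))"
    by (intro countable_SIGMA countable_rational_points countable_finite finite)
  ultimately show ?thesis using that range_from_nat_into by metis
qed

text \<open>The weights are the powers of the rational coordinates, some of which is positive at
  every path that is nonzero at a rational point. Homogeneity leaves 0 and infinity as the values of
  \<open>H\<close> at the zero path, while levels vanish there; the almost sure hypotheses exclude
  what levels cannot detect.\<close>

theorem homogeneous_integral_eq_of_levels:
  fixes Q Q' :: "(real ^ 'p \<Rightarrow> real ^ 'd) measure"
  assumes "0 < \<alpha>" and Q: "sets Q = sets path_space" and Q': "sets Q' = sets path_space"
    and eq: "\<And>J. constraints J \<Longrightarrow> (\<integral>\<^sup>+f. level \<alpha> J f \<partial>Q) = (\<integral>\<^sup>+f. level \<alpha> J f \<partial>Q')"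
    and fin: "\<And>t k. (\<integral>\<^sup>+f. ennreal ((f t $ k) powr \<alpha>) \<partial>Q) < \<top>"
    and H: "H \<in> homogeneous_maps \<alpha>"
    and ae: "AE f in Q. \<exists>t\<in>rational_points. f t \<noteq> 0" "AE f in Q'. \<exists>t\<in>rational_points. f t \<noteq> 0"
  shows "(\<integral>\<^sup>+f. H f \<partial>Q) = (\<integral>\<^sup>+f. H f \<partial>Q')"
proof -
  obtain c :: "nat \<Rightarrow> (real ^ 'p) \<times> 'd" where c: "range c = rational_points \<times> UNIV"
    using coordinate_enumeration by blast
  define w where "w n f = (f (fst (c n)) $ snd (c n)) powr \<alpha>" for n and f :: "real ^ 'p \<Rightarrow> real ^ 'd"
  have pos: "\<exists>n. 0 < w n f" if nz: "\<exists>t\<in>rational_points. f t \<noteq> 0" for f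
  proof -
    obtain t k where tk: "t \<in> rational_points" "f t $ k \<noteq> 0" using nz by (auto simp: vec_eq_iff)
    then have "(t, k) \<in> range c" unfolding c by simp
    then obtain n where "c n = (t, k)" by (metis imageE)
    then show ?thesis using tk by (intro exI[of _ n]) (simp add: w_def)
  qed
  show ?thesis
  proof (rule homogeneous_integral_eq[OF Q Q' _ _ _ _ H])
    show "w n \<in> borel_measurable path_space" for n
      unfolding w_def by (intro powr_real_measurable measurable_path_coord borel_measurable_const)
    show "0 \<le> w n f" for n f by (simp add: w_def)
    show "w n (\<lambda>t. r *\<^sub>R f t) = r powr \<alpha> * w n f" if "0 < r" "f \<in> paths" for n r f
      using that paths_nonneg by (simp add: w_def powr_mult)
    fix n and G :: "(real ^ 'p \<Rightarrow> real ^ 'd) \<Rightarrow> ennreal" assume G: "G \<in> homogeneous_maps 0"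
    have "(\<integral>\<^sup>+f. G f \<partial>tilt \<alpha> (\<lambda>f. f (fst (c n)) $ snd (c n)) R) = (\<integral>\<^sup>+f. ennreal (w n f) * G f \<partial>R)"
      if "sets R = sets path_space" for R
      unfolding w_def
      by (intro nn_integral_tilt_homogeneous that G measurable_path_coord paths_nonneg)
    from this[OF Q] this[OF Q']
    show "(\<integral>\<^sup>+f. ennreal (w n f) * G f \<partial>Q) = (\<integral>\<^sup>+f. ennreal (w n f) * G f \<partial>Q')"
      by (simp only: tilt_coordinate_eq[OF \<open>0 < \<alpha>\<close> Q Q' eq fin])
  next
    show "AE f in Q. H f = 0 \<or> (\<exists>n. 0 < w n f)" "AE f in Q'. H f = 0 \<or> (\<exists>n. 0 < w n f)"
      using ae pos by (auto elim: eventually_mono)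
  qed
qed

section \<open>Norms and mixtures\<close>

lemma is_norm_nonneg: "is_norm nrm \<Longrightarrow> 0 \<le> nrm x"
  and is_norm_eq_0: "is_norm nrm \<Longrightarrow> nrm x = 0 \<longleftrightarrow> x = 0"
  and is_norm_scale: "is_norm nrm \<Longrightarrow> nrm (c *\<^sub>R x) = \<bar>c\<bar> * nrm x"
  and is_norm_triangle: "is_norm nrm \<Longrightarrow> nrm (x + y) \<le> nrm x + nrm y"
  by (simp_all add: is_norm_def)

lemma is_norm_sum_le:
  assumes "is_norm nrm" "finite A" shows "nrm (\<Sum>i\<in>A. g i) \<le> (\<Sum>i\<in>A. nrm (g i))"
  using assms(2)
proof (induction A)
  case empty
  then show ?case using is_norm_eq_0[OF assms(1), of 0] by simp
next
  case (insert i A)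
  then show ?case using is_norm_triangle[OF assms(1), of "g i" "sum g A"] by simp
qed

text \<open>A norm given as a bare function is Lipschitz for the Euclidean norm, with constant the
  sum of its values on the standard basis. Its Borel measurability comes from here.\<close>

lemma continuous_on_is_norm:
  fixes nrm :: "real ^ 'd \<Rightarrow> real"
  assumes nrm: "is_norm nrm"
  shows "continuous_on UNIV nrm"
proof -
  define C where "C = (\<Sum>b\<in>Basis. nrm b)"
  have C: "nrm x \<le> C * norm x" for x
  proof -
    have "nrm x = nrm (\<Sum>b\<in>Basis. (x \<bullet> b) *\<^sub>R b)" by (simp only: euclidean_representation)
    also have "\<dots> \<le> (\<Sum>b\<in>Basis. nrm ((x \<bullet> b) *\<^sub>R b))" by (rule is_norm_sum_le[OF nrm]) simp
    also have "\<dots> \<le> (\<Sum>b\<in>Basis. norm x * nrm b)"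
      using Basis_le_norm is_norm_nonneg[OF nrm]
      by (intro sum_mono) (auto simp: is_norm_scale[OF nrm] intro!: mult_right_mono)
    finally show ?thesis by (simp add: C_def sum_distrib_left mult.commute)
  qed
  have "\<bar>nrm x - nrm y\<bar> \<le> C * norm (x - y)" for x y
  proof -
    have "nrm x \<le> nrm (x - y) + nrm y" using is_norm_triangle[OF nrm, of "x - y" y] by simp
    moreover have "nrm y \<le> nrm (y - x) + nrm x" using is_norm_triangle[OF nrm, of "y - x" x] by simp
    ultimately show ?thesis using C[of "x - y"] C[of "y - x"] by (simp add: norm_minus_commute abs_le_iff)
  qed
  moreover have "0 \<le> C" unfolding C_def using is_norm_nonneg[OF nrm] by (intro sum_nonneg)
  ultimately have "C-lipschitz_on UNIV nrm" by (intro lipschitz_onI) (simp_all add: dist_norm)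
  then show ?thesis by (rule lipschitz_on_continuous_on)
qed

lemma measurable_is_norm:
  fixes nrm :: "real ^ 'd \<Rightarrow> real"
  assumes "is_norm nrm"
  shows "nrm \<in> borel_measurable borel"
  by (rule borel_measurable_continuous_onI[OF continuous_on_is_norm[OF assms]])

lemma measurable_path_norm:
  fixes nrm :: "real ^ 'd \<Rightarrow> real"
  assumes "is_norm nrm"
  shows "(\<lambda>f. nrm (f t)) \<in> borel_measurable path_space"
  by (rule measurable_compose[OF measurable_path_eval measurable_is_norm[OF assms]])

lemma path_eq_0:
  fixes f :: "real ^ 'p \<Rightarrow> real ^ 'd"
  assumes f: "f \<in> paths" and zero: "\<And>s. s \<in> rational_points \<Longrightarrow> f s = 0"
  shows "f t = 0"
proof -
  obtain r :: "nat \<Rightarrow> real ^ 'p" where r: "\<And>n. r n \<in> rational_points" "r \<longlonglongrightarrow> t"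
    using rational_points_dense[of t] by blast
  have "(\<lambda>n. f (r n)) \<longlonglongrightarrow> f t"
    using f r(2) by (intro continuous_on_tendsto_compose[of UNIV f]) (auto simp: paths_def)
  then show ?thesis using zero[OF r(1)] by (simp add: LIMSEQ_const_iff)
qed

text \<open>A bijection, whereas the coordinates were enumerated by a mere surjection: the sum over
  rational points is reindexed along it, and the events \<open>W \<omega> = r n\<close> have to be
  disjoint.\<close>

lemma rational_enumeration:
  obtains r :: "nat \<Rightarrow> real ^ 'p" where "bij_betw r UNIV rational_points"
proof -
  have "inj (\<lambda>n :: nat. (\<chi> i. of_nat n) :: real ^ 'p)" by (intro injI) (simp add: vec_eq_iff)
  then have "infinite (range (\<lambda>n :: nat. (\<chi> i. of_nat n) :: real ^ 'p))" by (rule range_inj_infinite)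
  moreover have "range (\<lambda>n :: nat. (\<chi> i. of_nat n) :: real ^ 'p) \<subseteq> rational_points"
    by (auto simp: rational_points_def)
  ultimately have "infinite (rational_points :: (real ^ 'p) set)" using finite_subset by blast
  then show ?thesis using that bij_betw_from_nat_into[OF countable_rational_points] by blast
qed

text \<open>In the divergent case both sides are 0 by convention, as \<open>infsum\<close> of a
  family that is not summable and as \<open>enn2real \<top>\<close>.\<close>

lemma infsum_eq_enn2real_suminf:
  fixes g :: "nat \<Rightarrow> real"
  assumes "\<And>n. 0 \<le> g n"
  shows "infsum g UNIV = enn2real (\<Sum>n. ennreal (g n))"
proof (cases "summable g")
  case True
  then have "infsum g UNIV = suminf g"
    using assms by (intro infsumI norm_summable_imp_has_sum) (auto simp: summable_sums)
  moreover have "(\<Sum>n. ennreal (g n)) = ennreal (suminf g)" using assms True by (rule suminf_ennreal2)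
  ultimately show ?thesis using suminf_nonneg[OF True assms] by simp
next
  case False
  then have "\<not> g summable_on UNIV" using summable_on_UNIV_nonneg_real_iff assms by blast
  then have "infsum g UNIV = 0" by (rule infsum_not_exists)
  moreover have "(\<Sum>n. ennreal (g n)) = \<top>" using False assms summable_suminf_not_top by blast
  ultimately show ?thesis by simp
qed

text \<open>Here the splitting is applied to H = \<open>level \<alpha> J\<close> with powers of
  norms as weights. A path all of whose weights vanish is zero at the rational points, hence zero by
  continuity, and then its level is 0 as well.\<close>

theorem max_stable_law_eq_of_tilts:
  fixes Q Q' :: "(real ^ 'p \<Rightarrow> real ^ 'd) measure"
  assumes "0 < \<alpha>" and nrm: "is_norm nrm"
    and "prob_space Q" and Q: "sets Q = sets path_space" and "prob_space Q'" and Q': "sets Q' = sets path_space"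
    and eq: "\<And>G h. G \<in> homogeneous_maps 0 \<Longrightarrow>
      (\<integral>\<^sup>+f. ennreal (nrm (f h) powr \<alpha>) * G f \<partial>Q) = (\<integral>\<^sup>+f. ennreal (nrm (f h) powr \<alpha>) * G f \<partial>Q')"
  shows "max_stable_law \<alpha> Q = max_stable_law \<alpha> Q'"
proof (rule max_stable_law_eqI)
  fix J :: "(((real ^ 'p) \<times> 'd) \<times> real) set" assume J: "constraints J"
  obtain r :: "nat \<Rightarrow> real ^ 'p" where r: "bij_betw r UNIV rational_points" using rational_enumeration .
  have nz: "level \<alpha> J f = 0 \<or> (\<exists>n. 0 < nrm (f (r n)) powr \<alpha>)" if f: "f \<in> paths" for f
  proof (rule disjCI)
    assume "\<not> (\<exists>n. 0 < nrm (f (r n)) powr \<alpha>)"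
    then have "f (r n) = 0" for n using is_norm_eq_0[OF nrm] by auto
    then have "f s = 0" if "s \<in> rational_points" for s using r that by (metis bij_betw_imp_surj_on imageE)
    then have "f t = 0" for t using path_eq_0[OF f] by blast
    then show "level \<alpha> J f = 0" by (rule level_zero[OF \<open>0 < \<alpha>\<close>])
  qed
  show "(\<integral>\<^sup>+f. level \<alpha> J f \<partial>Q) = (\<integral>\<^sup>+f. level \<alpha> J f \<partial>Q')"
  proof (rule homogeneous_integral_eq[OF Q Q', where w="\<lambda>n f. nrm (f (r n)) powr \<alpha>" and \<alpha>=\<alpha>])
    show "(\<lambda>f. nrm (f (r n)) powr \<alpha>) \<in> borel_measurable path_space" for n
      by (intro powr_real_measurable measurable_path_norm[OF nrm] borel_measurable_const)
    show "nrm (c *\<^sub>R f (r n)) powr \<alpha> = c powr \<alpha> * nrm (f (r n)) powr \<alpha>" if "0 < c" for n c f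
      using that is_norm_nonneg[OF nrm] by (simp add: is_norm_scale[OF nrm] powr_mult)
    have "AE f in R. level \<alpha> J f = 0 \<or> (\<exists>n. 0 < nrm (f (r n)) powr \<alpha>)" if "sets R = sets path_space" for R
      using nz sets_eq_imp_space_eq[OF that] unfolding space_path_space by (intro AE_I2) blast
    from this[OF Q] this[OF Q']
    show "AE f in Q. level \<alpha> J f = 0 \<or> (\<exists>n. 0 < nrm (f (r n)) powr \<alpha>)"
      "AE f in Q'. level \<alpha> J f = 0 \<or> (\<exists>n. 0 < nrm (f (r n)) powr \<alpha>)" .
  qed (use eq level_in_homogeneous_maps[OF J] in auto)
qed (use assms in auto)

section \<open>The normalised mixture\<close>

definition weighted_mass ::
    "(real ^ 'd \<Rightarrow> real) \<Rightarrow> real \<Rightarrow> (nat \<Rightarrow> real ^ 'p) \<Rightarrow> (real ^ 'p \<Rightarrow> real) \<Rightarrow> (real ^ 'p \<Rightarrow> real ^ 'd) \<Rightarrow> ennreal" where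
  "weighted_mass nrm \<alpha> r p f = (\<Sum>n. ennreal (nrm (f (r n)) powr \<alpha> * p (r n)))"

text \<open>A map of the path space into itself, so that the mixture is a measurable image of the
  selected tilted process. Mass 0 and mass infinity both lead to the zero path, in accordance with
  the conventions of \<open>mixed_process\<close>.\<close>

definition normalise ::
    "(real ^ 'd \<Rightarrow> real) \<Rightarrow> real \<Rightarrow> (nat \<Rightarrow> real ^ 'p) \<Rightarrow> (real ^ 'p \<Rightarrow> real) \<Rightarrow> (real ^ 'p \<Rightarrow> real ^ 'd) \<Rightarrow> real ^ 'p \<Rightarrow> real ^ 'd" where
  "normalise nrm \<alpha> r p f = (\<lambda>t. (1 / enn2real (weighted_mass nrm \<alpha> r p f) powr (1 / \<alpha>)) *\<^sub>R f t)"

lemma mixed_process_eq_normalise: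
  assumes "bij_betw r UNIV rational_points" "\<And>t. t \<in> rational_points \<Longrightarrow> 0 \<le> p t" and "is_norm nrm"
  shows "mixed_process nrm \<alpha> p W \<Theta> \<omega> = normalise nrm \<alpha> r p (\<Theta> (W \<omega>) \<omega>)"
proof -
  let ?f = "\<Theta> (W \<omega>) \<omega>"
  have "(\<Sum>\<^sub>\<infinity>s\<in>rational_points. nrm (?f s) powr \<alpha> * p s) = (\<Sum>\<^sub>\<infinity>n. nrm (?f (r n)) powr \<alpha> * p (r n))"
    by (rule infsum_reindex_bij_betw[OF assms(1), symmetric])
  also have "\<dots> = enn2real (weighted_mass nrm \<alpha> r p ?f)"
    unfolding weighted_mass_def using assms(2) bij_betwE[OF assms(1)]
    by (intro infsum_eq_enn2real_suminf) auto
  finally show ?thesis by (intro ext) (simp add: mixed_process_def normalise_def)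
qed

lemma measurable_weighted_mass:
  assumes "is_norm nrm"
  shows "weighted_mass nrm \<alpha> r p \<in> borel_measurable path_space"
  unfolding weighted_mass_def
  by (intro borel_measurable_suminf_order measurable_compose[OF _ measurable_ennreal] borel_measurable_times
      powr_real_measurable measurable_path_norm[OF assms] borel_measurable_const)

lemma measurable_normalise:
  assumes "is_norm nrm"
  shows "normalise nrm \<alpha> r p \<in> path_space \<rightarrow>\<^sub>M path_space"
  unfolding normalise_def
proof (rule measurable_path_scale)
  have "(\<lambda>f. enn2real (weighted_mass nrm \<alpha> r p f)) \<in> borel_measurable path_space"
    by (rule measurable_compose[OF measurable_weighted_mass[OF assms] borel_measurable_enn2real]) simp
  then show "(\<lambda>f. 1 / enn2real (weighted_mass nrm \<alpha> r p f) powr (1 / \<alpha>)) \<in> borel_measurable path_space"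
    by (intro borel_measurable_divide powr_real_measurable borel_measurable_const)
qed simp_all

lemma weighted_mass_scale:
  assumes "is_norm nrm" "0 < c" and p: "\<And>n. 0 \<le> p (r n)"
  shows "weighted_mass nrm \<alpha> r p (\<lambda>t. c *\<^sub>R f t) = ennreal (c powr \<alpha>) * weighted_mass nrm \<alpha> r p f"
proof -
  have "ennreal (nrm (c *\<^sub>R f (r n)) powr \<alpha> * p (r n)) = ennreal (c powr \<alpha>) * ennreal (nrm (f (r n)) powr \<alpha> * p (r n))" for n
    using assms by (simp add: is_norm_scale powr_mult ennreal_mult[symmetric] mult.assoc)
  then show ?thesis unfolding weighted_mass_def by simp
qed

text \<open>On paths, H of the normalised path is \<open>K\<close>, which is H divided by the mass
  S. Both scale by the same power, so K is 0-homogeneous and its mean under the tilt at h is that of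
  ||Z(h)||^\<alpha> K(Z). Independence supplies the factor p(h), and summation over h leaves the
  mean of S K. The hypothesis \<open>H0\<close> treats the paths that normalisation sends to
  zero.\<close>

theorem nn_integral_mixture:
  fixes Q :: "(real ^ 'p \<Rightarrow> real ^ 'd) measure" and P :: "'q measure"
  assumes "0 < \<alpha>" and nrm: "is_norm nrm" and Q: "sets Q = sets path_space"
    and unit: "\<And>h. (\<integral>\<^sup>+f. ennreal (nrm (f h) powr \<alpha>) \<partial>Q) = 1"
    and P: "prob_space P"
    and \<Theta>: "\<And>h. \<Theta> h \<in> P \<rightarrow>\<^sub>M path_space" "\<And>h. distr P path_space (\<Theta> h) = tilt \<alpha> (\<lambda>f. nrm (f h)) Q"
    and W: "W \<in> P \<rightarrow>\<^sub>M count_space rational_points"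
    and indep: "\<And>h A. h \<in> rational_points \<Longrightarrow> A \<in> sets path_space \<Longrightarrow>
      emeasure P {\<omega> \<in> space P. W \<omega> = h \<and> \<Theta> h \<omega> \<in> A}
        = emeasure P {\<omega> \<in> space P. W \<omega> = h} * emeasure P {\<omega> \<in> space P. \<Theta> h \<omega> \<in> A}"
    and p: "\<And>t. t \<in> rational_points \<Longrightarrow> p t = measure P {\<omega> \<in> space P. W \<omega> = t}"
      "\<And>t. t \<in> rational_points \<Longrightarrow> 0 < p t"
    and r: "bij_betw r UNIV rational_points"
    and H: "H \<in> homogeneous_maps \<alpha>" and H0: "\<And>f. (\<And>t. f t = 0) \<Longrightarrow> H f = 0"
  shows "(\<integral>\<^sup>+\<omega>. H (normalise nrm \<alpha> r p (\<Theta> (W \<omega>) \<omega>)) \<partial>P) = (\<integral>\<^sup>+f. H f \<partial>Q)"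
proof -
  interpret P: prob_space P by fact
  define S where "S = weighted_mass nrm \<alpha> r p"
  define K where "K f = ennreal (inverse (enn2real (S f))) * H f" for f
  have rr: "r n \<in> rational_points" for n using bij_betwE[OF r] by simp
  have p0: "0 \<le> p (r n)" for n using p(2)[OF rr] by (rule less_imp_le)
  have Hm: "H \<in> borel_measurable path_space" using H by (simp add: homogeneous_maps_def)
  have Sm: "S \<in> borel_measurable path_space" unfolding S_def by (rule measurable_weighted_mass[OF nrm])
  have Km: "K \<in> borel_measurable path_space"
    unfolding K_def
    by (intro borel_measurable_times borel_measurable_times_ennreal Hm measurable_compose[OF _ measurable_ennreal] borel_measurable_inverse
        measurable_compose[OF Sm borel_measurable_enn2real]) simp
  have HK: "H (normalise nrm \<alpha> r p f) = K f" if f: "f \<in> paths" for f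
  proof (cases "enn2real (S f) = 0")
    case True
    then show ?thesis using H0 by (simp add: normalise_def K_def S_def)
  next
    case False
    then have pos: "0 < enn2real (S f)" using enn2real_nonneg[of "S f"] by linarith
    define c where "c = 1 / enn2real (S f) powr (1 / \<alpha>)"
    have c: "0 < c" using pos by (simp add: c_def)
    have "H (\<lambda>t. c *\<^sub>R f t) = ennreal (c powr \<alpha>) * H f"
      using H c f by (simp add: homogeneous_maps_def)
    moreover have "c powr \<alpha> = inverse (enn2real (S f))"
      using pos \<open>0 < \<alpha>\<close> by (simp add: c_def powr_divide powr_powr inverse_eq_divide)
    ultimately show ?thesis by (simp add: normalise_def K_def S_def c_def)
  qed
  have Khom: "K \<in> homogeneous_maps 0"
  proof -
    have "K (\<lambda>t. c *\<^sub>R f t) = K f" if c: "0 < c" and f: "f \<in> paths" for c f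
    proof -
      have "enn2real (S (\<lambda>t. c *\<^sub>R f t)) = c powr \<alpha> * enn2real (S f)"
        unfolding S_def weighted_mass_scale[where p=p, OF nrm c p0] by (simp add: enn2real_mult)
      moreover have "H (\<lambda>t. c *\<^sub>R f t) = ennreal (c powr \<alpha>) * H f"
        using H c f by (simp add: homogeneous_maps_def)
      moreover have "inverse (c powr \<alpha> * enn2real (S f)) * c powr \<alpha> = inverse (enn2real (S f))"
        using c by (simp add: field_simps)
      ultimately show ?thesis
        unfolding K_def by (simp add: mult.assoc[symmetric] ennreal_mult[symmetric] del: inverse_mult_distrib)
    qed
    then show ?thesis using Km by (simp add: homogeneous_maps_def)
  qed
  have Wset: "{\<omega> \<in> space P. W \<omega> = r n} \<in> sets P" for n
    using measurable_sets[OF W, of "{r n}"] rr by (simp add: vimage_def Int_def conj_commute)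
  have cond: "(\<integral>\<^sup>+\<omega>. indicator {\<omega> \<in> space P. W \<omega> = r n} \<omega> * K (\<Theta> (r n) \<omega>) \<partial>P)
      = ennreal (p (r n)) * (\<integral>\<^sup>+f. ennreal (nrm (f (r n)) powr \<alpha>) * K f \<partial>Q)" for n
  proof -
    \<comment> \<open>This is \<open>P\<close> restricted to the event that \<open>W\<close> selects
      \<open>r n\<close>, without renormalisation. By independence its image under
      \<open>\<Theta> (r n)\<close> is the law of \<open>\<Theta> (r n)\<close> scaled by p (r n),
      which amounts to conditioning without a division.\<close>
    let ?D = "density P (indicator {\<omega> \<in> space P. W \<omega> = r n})"
    have ind: "indicator {\<omega> \<in> space P. W \<omega> = r n} \<in> borel_measurable P"
      by (rule borel_measurable_indicator[OF Wset])
    have \<Theta>D: "\<Theta> (r n) \<in> ?D \<rightarrow>\<^sub>M path_space" using \<Theta>(1) by simp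
    have pn: "emeasure P {\<omega> \<in> space P. W \<omega> = r n} = ennreal (p (r n))"
      using p(1)[OF rr] by (simp add: P.emeasure_eq_measure)
    have "distr ?D path_space (\<Theta> (r n)) = scale_measure (ennreal (p (r n))) (distr P path_space (\<Theta> (r n)))"
    proof (rule measure_eqI)
      fix A assume "A \<in> sets (distr ?D path_space (\<Theta> (r n)))"
      then have A: "A \<in> sets path_space" by simp
      have \<Theta>A: "\<Theta> (r n) -` A \<inter> space P \<in> sets P" by (rule measurable_sets[OF \<Theta>(1) A])
      have "emeasure (distr ?D path_space (\<Theta> (r n))) A = emeasure ?D (\<Theta> (r n) -` A \<inter> space P)"
        by (subst emeasure_distr[OF \<Theta>D A]) simp
      also have "\<dots> = (\<integral>\<^sup>+\<omega>. indicator {\<omega> \<in> space P. W \<omega> = r n} \<omega> * indicator (\<Theta> (r n) -` A \<inter> space P) \<omega> \<partial>P)"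
        by (rule emeasure_density[OF ind \<Theta>A])
      also have "\<dots> = emeasure P ({\<omega> \<in> space P. W \<omega> = r n} \<inter> (\<Theta> (r n) -` A \<inter> space P))"
        using Wset \<Theta>A by (simp add: indicator_inter_arith[symmetric])
      also have "{\<omega> \<in> space P. W \<omega> = r n} \<inter> (\<Theta> (r n) -` A \<inter> space P) = {\<omega> \<in> space P. W \<omega> = r n \<and> \<Theta> (r n) \<omega> \<in> A}"
        by auto
      also have "emeasure P \<dots> = ennreal (p (r n)) * emeasure P {\<omega> \<in> space P. \<Theta> (r n) \<omega> \<in> A}"
        using indep[OF rr A] pn by simp
      also have "{\<omega> \<in> space P. \<Theta> (r n) \<omega> \<in> A} = \<Theta> (r n) -` A \<inter> space P" by auto
      also have "emeasure P \<dots> = emeasure (distr P path_space (\<Theta> (r n))) A"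
        by (rule emeasure_distr[OF \<Theta>(1) A, symmetric])
      finally show "emeasure (distr ?D path_space (\<Theta> (r n))) A
        = emeasure (scale_measure (ennreal (p (r n))) (distr P path_space (\<Theta> (r n)))) A" by simp
    qed simp
    then have "(\<integral>\<^sup>+f. K f \<partial>distr ?D path_space (\<Theta> (r n)))
        = ennreal (p (r n)) * (\<integral>\<^sup>+f. K f \<partial>tilt \<alpha> (\<lambda>f. nrm (f (r n))) Q)"
      using Km by (simp add: nn_integral_scale_measure \<Theta>(2) measurable_cong_sets[OF sets_tilt refl])
    moreover have "(\<integral>\<^sup>+f. K f \<partial>distr ?D path_space (\<Theta> (r n))) = (\<integral>\<^sup>+\<omega>. K (\<Theta> (r n) \<omega>) \<partial>?D)"
      by (rule nn_integral_distr[OF \<Theta>D]) (simp add: Km)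
    moreover have "\<dots> = (\<integral>\<^sup>+\<omega>. indicator {\<omega> \<in> space P. W \<omega> = r n} \<omega> * K (\<Theta> (r n) \<omega>) \<partial>P)"
      by (rule nn_integral_density[OF ind measurable_compose[OF \<Theta>(1) Km]])
    moreover have "(\<integral>\<^sup>+f. K f \<partial>tilt \<alpha> (\<lambda>f. nrm (f (r n))) Q) = (\<integral>\<^sup>+f. ennreal (nrm (f (r n)) powr \<alpha>) * K f \<partial>Q)"
      by (intro nn_integral_tilt_homogeneous Q measurable_path_norm nrm is_norm_nonneg Khom)
    ultimately show ?thesis by simp
  qed
  have paths\<Theta>: "\<Theta> h \<omega> \<in> paths" if "\<omega> \<in> space P" for h \<omega>
    using measurable_space[OF \<Theta>(1) that] by (simp add: space_path_space)
  have "(\<integral>\<^sup>+\<omega>. H (normalise nrm \<alpha> r p (\<Theta> (W \<omega>) \<omega>)) \<partial>P)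
      = (\<integral>\<^sup>+\<omega>. (\<Sum>n. indicator {\<omega> \<in> space P. W \<omega> = r n} \<omega> * K (\<Theta> (r n) \<omega>)) \<partial>P)"
  proof (rule nn_integral_cong)
    fix \<omega> assume \<omega>: "\<omega> \<in> space P"
    have "W \<omega> \<in> rational_points" using measurable_space[OF W \<omega>] by simp
    then obtain N where N: "W \<omega> = r N" using r by (metis bij_betw_imp_surj_on imageE)
    \<comment> \<open>Injectivity of \<open>r\<close> makes exactly one term survive, the one for
      the selected point.\<close>
    have "indicator {\<omega> \<in> space P. W \<omega> = r n} \<omega> * K (\<Theta> (r n) \<omega>) = (if n = N then K (\<Theta> (W \<omega>) \<omega>) else 0)" for n
      using \<omega> N bij_betw_imp_inj_on[OF r] by (auto simp: indicator_def dest: injD)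
    then show "H (normalise nrm \<alpha> r p (\<Theta> (W \<omega>) \<omega>)) = (\<Sum>n. indicator {\<omega> \<in> space P. W \<omega> = r n} \<omega> * K (\<Theta> (r n) \<omega>))"
      using sums_unique[OF sums_single[of N "\<lambda>_. K (\<Theta> (W \<omega>) \<omega>)"]] HK[OF paths\<Theta>[OF \<omega>]] by simp
  qed
  also have "\<dots> = (\<Sum>n. \<integral>\<^sup>+\<omega>. indicator {\<omega> \<in> space P. W \<omega> = r n} \<omega> * K (\<Theta> (r n) \<omega>) \<partial>P)"
    by (intro nn_integral_suminf borel_measurable_times borel_measurable_times_ennreal borel_measurable_indicator Wset measurable_compose[OF \<Theta>(1) Km])
  also have "\<dots> = (\<Sum>n. \<integral>\<^sup>+f. ennreal (nrm (f (r n)) powr \<alpha> * p (r n)) * K f \<partial>Q)"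
  proof (intro suminf_cong)
    fix n
    have "(\<lambda>f. ennreal (nrm (f (r n)) powr \<alpha>) * K f) \<in> borel_measurable Q"
      unfolding measurable_cong_sets[OF Q refl]
      by (intro borel_measurable_times borel_measurable_times_ennreal Km measurable_compose[OF _ measurable_ennreal] powr_real_measurable
          measurable_path_norm[OF nrm] borel_measurable_const)
    then have "ennreal (p (r n)) * (\<integral>\<^sup>+f. ennreal (nrm (f (r n)) powr \<alpha>) * K f \<partial>Q)
        = (\<integral>\<^sup>+f. ennreal (p (r n)) * (ennreal (nrm (f (r n)) powr \<alpha>) * K f) \<partial>Q)"
      by (rule nn_integral_cmult[symmetric])
    then show "(\<integral>\<^sup>+\<omega>. indicator {\<omega> \<in> space P. W \<omega> = r n} \<omega> * K (\<Theta> (r n) \<omega>) \<partial>P)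
        = (\<integral>\<^sup>+f. ennreal (nrm (f (r n)) powr \<alpha> * p (r n)) * K f \<partial>Q)"
      unfolding cond using p0 by (simp add: ennreal_mult mult_ac)
  qed
  also have "\<dots> = (\<integral>\<^sup>+f. (\<Sum>n. ennreal (nrm (f (r n)) powr \<alpha> * p (r n)) * K f) \<partial>Q)"
    by (intro nn_integral_suminf[symmetric]; unfold measurable_cong_sets[OF Q refl])
      (intro borel_measurable_times borel_measurable_times_ennreal Km measurable_compose[OF _ measurable_ennreal] powr_real_measurable
          measurable_path_norm[OF nrm] borel_measurable_const)
  also have "\<dots> = (\<integral>\<^sup>+f. S f * K f \<partial>Q)"
    by (simp add: S_def weighted_mass_def)
  also have "\<dots> = (\<integral>\<^sup>+f. H f \<partial>Q)"
  proof (rule nn_integral_cong_AE)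
    \<comment> \<open>The unit moments turn the mean of S into the sum of the probabilities of the
      values of \<open>W\<close>. It is finite, so S is finite almost surely and can be cancelled
      where it is positive.\<close>
    have "(\<integral>\<^sup>+f. S f \<partial>Q) = (\<Sum>n. \<integral>\<^sup>+f. ennreal (nrm (f (r n)) powr \<alpha> * p (r n)) \<partial>Q)"
      unfolding S_def weighted_mass_def
      by (intro nn_integral_suminf; unfold measurable_cong_sets[OF Q refl])
        (intro borel_measurable_times borel_measurable_times_ennreal measurable_compose[OF _ measurable_ennreal] powr_real_measurable
            measurable_path_norm[OF nrm] borel_measurable_const)
    also have "\<dots> = (\<Sum>n. emeasure P {\<omega> \<in> space P. W \<omega> = r n})"
    proof (intro suminf_cong)
      fix n
      have m: "(\<lambda>f. ennreal (nrm (f (r n)) powr \<alpha>)) \<in> borel_measurable Q"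
        unfolding measurable_cong_sets[OF Q refl]
        by (intro measurable_compose[OF _ measurable_ennreal] powr_real_measurable
            measurable_path_norm[OF nrm] borel_measurable_const)
      have "(\<integral>\<^sup>+f. ennreal (nrm (f (r n)) powr \<alpha> * p (r n)) \<partial>Q) = (\<integral>\<^sup>+f. ennreal (nrm (f (r n)) powr \<alpha>) * ennreal (p (r n)) \<partial>Q)"
        using p0 by (simp add: ennreal_mult)
      also have "\<dots> = ennreal (p (r n))" by (simp add: nn_integral_multc[OF m] unit)
      finally show "(\<integral>\<^sup>+f. ennreal (nrm (f (r n)) powr \<alpha> * p (r n)) \<partial>Q) = emeasure P {\<omega> \<in> space P. W \<omega> = r n}"
        using p(1)[OF rr] by (simp add: P.emeasure_eq_measure)
    qed
    also have "\<dots> = emeasure P (\<Union>n. {\<omega> \<in> space P. W \<omega> = r n})"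
      using Wset bij_betw_imp_inj_on[OF r]
      by (intro suminf_emeasure) (auto simp: disjoint_family_on_def dest: injD)
    also have "\<dots> \<noteq> \<infinity>" by simp
    finally have "AE f in Q. S f \<noteq> \<infinity>"
      by (intro nn_integral_PInf_AE; (unfold measurable_cong_sets[OF Q refl])?) (rule Sm)
    then show "AE f in Q. S f * K f = H f"
      using AE_space
    proof eventually_elim
      fix f assume Sf: "S f \<noteq> \<infinity>" and "f \<in> space Q"
      then have f: "f \<in> paths" using sets_eq_imp_space_eq[OF Q] by (simp add: space_path_space)
      show "S f * K f = H f"
      proof (cases "S f = 0")
        case True
        \<comment> \<open>Since p > 0 at every rational point, S = 0 forces the path to vanish on
          all of them, hence everywhere, and \<open>H0\<close> gives H = 0.\<close>
        have "f s = 0" if s: "s \<in> rational_points" for s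
        proof -
          obtain n where n: "s = r n" using r s by (metis bij_betw_imp_surj_on imageE)
          have "(\<Sum>n. ennreal (nrm (f (r n)) powr \<alpha> * p (r n))) = 0"
            using True by (simp add: S_def weighted_mass_def)
          then have "ennreal (nrm (f (r n)) powr \<alpha> * p (r n)) = 0" by (simp add: suminf_eq_zero_iff)
          then have "nrm (f (r n)) powr \<alpha> * p (r n) \<le> 0" by (simp add: ennreal_eq_0_iff)
          then have "nrm (f (r n)) = 0" using p(2)[OF rr, of n] is_norm_nonneg[OF nrm]
            by (auto simp: mult_le_0_iff)
          then show ?thesis using n is_norm_eq_0[OF nrm] by simp
        qed
        then have "f t = 0" for t using path_eq_0[OF f] by blast
        then show ?thesis using True H0 by simp
      next
        case False
        then obtain s where s: "S f = ennreal s" "0 < s" using Sf by (cases "S f") (auto simp: less_le)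
        then show ?thesis
          unfolding K_def by (simp add: mult.assoc[symmetric] ennreal_mult[symmetric])
      qed
    qed
  qed
  finally show ?thesis .
qed

section \<open>From processes to their laws on the path space\<close>

lemma prob_space_path_law:
  "path_process N Z \<Longrightarrow> prob_space (distr N path_space Z)"
  unfolding path_process_def by (auto intro: prob_space.prob_space_distr)

text \<open>By continuity a path that is nonzero somewhere is nonzero at a rational point. The
  countable form is a measurable event of the path space, so it passes from the process to its
  law.\<close>

lemma sup_norm_pos_AE:
  fixes Z :: "'z \<Rightarrow> real ^ 'p \<Rightarrow> real ^ 'd"
  assumes nrm: "is_norm nrm" and Z: "path_process N Z" and pos: "sup_norm_pos nrm N Z"
  shows "AE f in distr N path_space Z. \<exists>t\<in>rational_points. f t \<noteq> 0"
proof -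
  have N: "prob_space N" and Zm: "Z \<in> N \<rightarrow>\<^sub>M path_space" using Z by (simp_all add: path_process_def)
  have "{f \<in> space path_space. f t \<noteq> (0 :: real ^ 'd)} \<in> sets path_space" for t :: "real ^ 'p"
  proof -
    have "{f \<in> space path_space. f t \<noteq> (0 :: real ^ 'd)} = (\<lambda>f. f t :: real ^ 'd) -` (- {0}) \<inter> space path_space" by auto
    also have "\<dots> \<in> sets path_space" by (rule measurable_sets[OF measurable_path_eval]) simp
    finally show ?thesis .
  qed
  then have S: "{f \<in> space path_space. \<exists>t\<in>rational_points. f t \<noteq> (0 :: real ^ 'd)} \<in> sets (path_space :: (real ^ 'p \<Rightarrow> real ^ 'd) measure)"
    by (rule sets.sets_Collect_countable_Ex'[OF _ countable_rational_points])
  have "AE \<omega> in N. \<omega> \<in> {\<omega> \<in> space N. (SUP t. ennreal (nrm (Z \<omega> t))) > 0}"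
    using pos unfolding sup_norm_pos_def by (rule prob_space.AE_prob_1[OF N])
  then have "AE \<omega> in N. \<exists>t\<in>rational_points. Z \<omega> t \<noteq> 0"
  proof (rule eventually_mono)
    fix \<omega> assume \<omega>: "\<omega> \<in> {\<omega> \<in> space N. (SUP t. ennreal (nrm (Z \<omega> t))) > 0}"
    then obtain t where "0 < nrm (Z \<omega> t)" by (auto simp: less_SUP_iff)
    then have "Z \<omega> t \<noteq> 0" using is_norm_eq_0[OF nrm, of "Z \<omega> t"] by auto
    moreover have "Z \<omega> \<in> paths" using measurable_space[OF Zm, of \<omega>] \<omega> by (simp add: space_path_space)
    ultimately show "\<exists>t\<in>rational_points. Z \<omega> t \<noteq> 0" using path_eq_0 by blast
  qed
  then show ?thesis unfolding AE_distr_iff[OF Zm S] .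
qed

text \<open>The normalising constant is 1, so the defining formula of the tilted process is the
  image measure \<open>tilt\<close> evaluated on measurable sets.\<close>

lemma tilted_process_law:
  fixes Z :: "'z \<Rightarrow> real ^ 'p \<Rightarrow> real ^ 'd" and \<Theta> :: "'q \<Rightarrow> real ^ 'p \<Rightarrow> real ^ 'd"
  assumes nrm: "is_norm nrm" and Z: "Z \<in> N \<rightarrow>\<^sub>M path_space"
    and unit: "(\<integral>\<^sup>+\<omega>. ennreal (nrm (Z \<omega> h) powr \<alpha>) \<partial>N) = 1"
    and \<Theta>: "tilted_process nrm \<alpha> N Z h P \<Theta>"
  shows "distr P path_space \<Theta> = tilt \<alpha> (\<lambda>f. nrm (f h)) (distr N path_space Z)"
proof (rule measure_eqI)
  have \<Theta>m: "\<Theta> \<in> P \<rightarrow>\<^sub>M path_space" using \<Theta> by (simp add: tilted_process_def path_process_def)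
  fix A assume "A \<in> sets (distr P path_space \<Theta>)"
  then have A: "A \<in> sets path_space" by simp
  have scale: "(\<lambda>f t. inverse (nrm (f h)) *\<^sub>R f t) \<in> path_space \<rightarrow>\<^sub>M (path_space :: (real ^ 'p \<Rightarrow> real ^ 'd) measure)"
    by (intro measurable_path_scale borel_measurable_inverse measurable_path_norm[OF nrm])
      (auto simp: is_norm_nonneg[OF nrm])
  have m: "(\<lambda>f. ennreal (nrm (f h) powr \<alpha>) * indicator A (\<lambda>t. inverse (nrm (f h)) *\<^sub>R f t)) \<in> borel_measurable path_space"
    by (intro borel_measurable_times_ennreal measurable_compose[OF _ measurable_ennreal] powr_real_measurable
        measurable_path_norm[OF nrm] borel_measurable_const measurable_compose[OF scale borel_measurable_indicator[OF A]])
  have "emeasure (distr P path_space \<Theta>) A = emeasure P {\<omega> \<in> space P. \<Theta> \<omega> \<in> A}"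
    unfolding emeasure_distr[OF \<Theta>m A] by (rule arg_cong[where f="emeasure P"]) auto
  also have "\<dots> = (\<integral>\<^sup>+\<omega>. ennreal (nrm (Z \<omega> h) powr \<alpha>) * indicator A (\<lambda>t. inverse (nrm (Z \<omega> h)) *\<^sub>R Z \<omega> t) \<partial>N)"
    using \<Theta> A unit by (simp add: tilted_process_def divide_ennreal_def)
  also have "\<dots> = (\<integral>\<^sup>+f. ennreal (nrm (f h) powr \<alpha>) * indicator A (\<lambda>t. inverse (nrm (f h)) *\<^sub>R f t) \<partial>distr N path_space Z)"
    by (rule nn_integral_distr[OF Z, symmetric]) (simp only: measurable_distr_eq1 m)
  also have "\<dots> = (\<integral>\<^sup>+f. indicator A f \<partial>tilt \<alpha> (\<lambda>f. nrm (f h)) (distr N path_space Z))"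
    by (rule nn_integral_tilt[symmetric])
      (simp_all add: measurable_path_norm[OF nrm] is_norm_nonneg[OF nrm] borel_measurable_indicator[OF A])
  also have "\<dots> = emeasure (tilt \<alpha> (\<lambda>f. nrm (f h)) (distr N path_space Z)) A"
    using A by (simp add: sets_tilt)
  finally show "emeasure (distr P path_space \<Theta>) A = emeasure (tilt \<alpha> (\<lambda>f. nrm (f h)) (distr N path_space Z)) A" .
qed (simp add: sets_tilt)

text \<open>The product rule for the two indices \<open>None\<close> and \<open>Some h\<close>,
  applied to the preimages of the point \<open>h\<close> and of the set \<open>A\<close>.\<close>

lemma indep_selectorD:
  assumes P: "prob_space P" and indep: "indep_selector P W \<Theta>"
    and h: "h \<in> rational_points" and A: "A \<in> sets path_space"
  shows "emeasure P {\<omega> \<in> space P. W \<omega> = h \<and> \<Theta> h \<omega> \<in> A}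
    = emeasure P {\<omega> \<in> space P. W \<omega> = h} * emeasure P {\<omega> \<in> space P. \<Theta> h \<omega> \<in> A}"
proof -
  interpret prob_space P by fact
  let ?B = "case_option {\<omega> \<in> space P. W \<omega> = h} (\<lambda>_. {\<omega> \<in> space P. \<Theta> h \<omega> \<in> A})"
  have "W -` {h} \<inter> space P \<in> sets (vimage_algebra (space P) W (count_space rational_points))"
    using h by (intro in_vimage_algebra) simp
  moreover have "\<Theta> h -` A \<inter> space P \<in> sets (vimage_algebra (space P) (\<Theta> h) path_space)"
    by (rule in_vimage_algebra[OF A])
  moreover have "W -` {h} \<inter> space P = {\<omega> \<in> space P. W \<omega> = h}" "\<Theta> h -` A \<inter> space P = {\<omega> \<in> space P. \<Theta> h \<omega> \<in> A}"
    by auto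
  ultimately have "prob (\<Inter>j\<in>{None, Some h}. ?B j) = (\<Prod>j\<in>{None, Some h}. prob (?B j))"
    using indep unfolding indep_selector_def by (intro indep_setsD) auto
  moreover have "(\<Inter>j\<in>{None, Some h}. ?B j) = {\<omega> \<in> space P. W \<omega> = h \<and> \<Theta> h \<omega> \<in> A}" by auto
  ultimately show ?thesis by (simp add: emeasure_eq_measure ennreal_mult)
qed

theorem proposition2p1:
  fixes \<alpha> :: real
    and nrm :: "real ^ 'd \<Rightarrow> real"
    and MX :: "'x measure" and X :: "'x \<Rightarrow> real ^ 'p \<Rightarrow> real ^ 'd"
    and MZ :: "'z measure" and Z :: "'z \<Rightarrow> real ^ 'p \<Rightarrow> real ^ 'd"
    and MZ' :: "'v measure" and Z' :: "'v \<Rightarrow> real ^ 'p \<Rightarrow> real ^ 'd"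
  assumes "\<alpha> > 0"
    and "is_norm nrm"
    and "path_process MX X"
    and "spectral_process \<alpha> MX X MZ Z"
    and "frechet_marginals \<alpha> MX X MZ Z"
    and "sup_norm_pos nrm MZ Z"
    and "\<And>t. (\<integral>\<^sup>+\<omega>. ennreal (nrm (Z \<omega> t) powr \<alpha>) \<partial>MZ) = 1"
    and "path_process MZ' Z'"
  shows
    "(spectral_process \<alpha> MX X MZ' Z' \<and> sup_norm_pos nrm MZ' Z' \<longrightarrow>
        (\<forall>H \<in> homogeneous_maps \<alpha>. (\<integral>\<^sup>+\<omega>. H (Z \<omega>) \<partial>MZ) = (\<integral>\<^sup>+\<omega>. H (Z' \<omega>) \<partial>MZ')))
   \<and> ((\<forall>h. (\<integral>\<^sup>+\<omega>. ennreal (nrm (Z' \<omega> h) powr \<alpha>) \<partial>MZ') = 1) \<and>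
      (\<forall>G \<in> homogeneous_maps 0. \<forall>h.
         (\<integral>\<^sup>+\<omega>. ennreal (nrm (Z \<omega> h) powr \<alpha>) * G (Z \<omega>) \<partial>MZ) =
         (\<integral>\<^sup>+\<omega>. ennreal (nrm (Z' \<omega> h) powr \<alpha>) * G (Z' \<omega>) \<partial>MZ')) \<longrightarrow>
        (\<forall>(MX' :: 'y measure) (X' :: 'y \<Rightarrow> real ^ 'p \<Rightarrow> real ^ 'd).
           spectral_process \<alpha> MX' X' MZ' Z' \<longrightarrow> process_law MX X = process_law MX' X'))
   \<and> (\<forall>(P :: 'q measure) (\<Theta> :: real ^ 'p \<Rightarrow> 'q \<Rightarrow> real ^ 'p \<Rightarrow> real ^ 'd)
        (W :: 'q \<Rightarrow> real ^ 'p) (p :: real ^ 'p \<Rightarrow> real).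
        prob_space P \<and>
        (\<forall>h. tilted_process nrm \<alpha> MZ Z h P (\<Theta> h)) \<and>
        W \<in> P \<rightarrow>\<^sub>M count_space rational_points \<and>
        indep_selector P W \<Theta> \<and>
        (\<forall>t \<in> rational_points. p t = measure P {\<omega> \<in> space P. W \<omega> = t} \<and> p t > 0) \<longrightarrow>
        spectral_process \<alpha> MX X P (mixed_process nrm \<alpha> p W \<Theta>))"
proof (intro conjI impI allI)
  have nrm: "is_norm nrm" by fact
  have Zp: "path_process MZ Z" and law: "process_law MX X = max_stable_law \<alpha> (distr MZ path_space Z)"
    and X: "nonneg_process MX X"
    using assms(4) by (simp_all add: spectral_process_def)
  have Zm: "Z \<in> MZ \<rightarrow>\<^sub>M path_space" and Zm': "Z' \<in> MZ' \<rightarrow>\<^sub>M path_space"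
    using Zp assms(8) by (simp_all add: path_process_def)
  let ?Q = "distr MZ path_space Z" and ?Q' = "distr MZ' path_space Z'"
  have Q: "prob_space ?Q" "sets ?Q = sets path_space" using prob_space_path_law[OF Zp] by simp_all
  have Q': "prob_space ?Q'" "sets ?Q' = sets path_space" using prob_space_path_law[OF assms(8)] by simp_all
  have int: "(\<integral>\<^sup>+f. F f \<partial>?Q) = (\<integral>\<^sup>+\<omega>. F (Z \<omega>) \<partial>MZ)" "(\<integral>\<^sup>+f. F f \<partial>?Q') = (\<integral>\<^sup>+\<omega>. F (Z' \<omega>) \<partial>MZ')"
    if "F \<in> borel_measurable path_space" for F
    by (rule nn_integral_distr[OF Zm], simp only: measurable_distr_eq1 that)
      (rule nn_integral_distr[OF Zm'], simp only: measurable_distr_eq1 that)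
  have normm: "(\<lambda>f. ennreal (nrm (f h) powr \<alpha>)) \<in> borel_measurable path_space" for h :: "real ^ 'p"
    by (intro measurable_compose[OF _ measurable_ennreal] powr_real_measurable
        measurable_path_norm[OF nrm] borel_measurable_const)
  have unit: "(\<integral>\<^sup>+f. ennreal (nrm (f h) powr \<alpha>) \<partial>?Q) = 1" for h
    unfolding int(1)[OF normm] by (rule assms(7))

  show "\<forall>H\<in>homogeneous_maps \<alpha>. (\<integral>\<^sup>+\<omega>. H (Z \<omega>) \<partial>MZ) = (\<integral>\<^sup>+\<omega>. H (Z' \<omega>) \<partial>MZ')"
    if *: "spectral_process \<alpha> MX X MZ' Z' \<and> sup_norm_pos nrm MZ' Z'"
  proof
    fix H :: "(real ^ 'p \<Rightarrow> real ^ 'd) \<Rightarrow> ennreal" assume H: "H \<in> homogeneous_maps \<alpha>"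
    have "max_stable_law \<alpha> ?Q = max_stable_law \<alpha> ?Q'" using * law by (simp add: spectral_process_def)
    note levels = max_stable_law_eqD[OF \<open>0 < \<alpha>\<close> Q Q' this]
    \<comment> \<open>The Frechet marginals enter here: their scale parameter is the finite moment
      of the coordinate.\<close>
    have fin: "(\<integral>\<^sup>+f. ennreal ((f t $ k) powr \<alpha>) \<partial>?Q) < \<top>" for t k
    proof -
      have "(\<lambda>f. ennreal ((f t $ k) powr \<alpha>)) \<in> borel_measurable (path_space :: (real ^ 'p \<Rightarrow> real ^ 'd) measure)"
        by (intro measurable_compose[OF _ measurable_ennreal] powr_real_measurable
            measurable_path_coord borel_measurable_const)
      moreover obtain a where "(\<integral>\<^sup>+\<omega>. ennreal ((Z \<omega> t $ k) powr \<alpha>) \<partial>MZ) = ennreal a"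
        using assms(5) unfolding frechet_marginals_def by blast
      ultimately show ?thesis by (simp only: int(1) ennreal_less_top)
    qed
    have "(\<integral>\<^sup>+f. H f \<partial>?Q) = (\<integral>\<^sup>+f. H f \<partial>?Q')"
      using * by (intro homogeneous_integral_eq_of_levels[OF \<open>0 < \<alpha>\<close> Q(2) Q'(2) levels fin H]
          sup_norm_pos_AE[OF nrm] Zp assms(6,8)) auto
    moreover have "H \<in> borel_measurable path_space" using H by (simp add: homogeneous_maps_def)
    ultimately show "(\<integral>\<^sup>+\<omega>. H (Z \<omega>) \<partial>MZ) = (\<integral>\<^sup>+\<omega>. H (Z' \<omega>) \<partial>MZ')" by (simp only: int)
  qed

  show "process_law MX X = process_law MX' X'"
    if *: "(\<forall>h. (\<integral>\<^sup>+\<omega>. ennreal (nrm (Z' \<omega> h) powr \<alpha>) \<partial>MZ') = 1) \<and>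
      (\<forall>G \<in> homogeneous_maps 0. \<forall>h.
         (\<integral>\<^sup>+\<omega>. ennreal (nrm (Z \<omega> h) powr \<alpha>) * G (Z \<omega>) \<partial>MZ) =
         (\<integral>\<^sup>+\<omega>. ennreal (nrm (Z' \<omega> h) powr \<alpha>) * G (Z' \<omega>) \<partial>MZ'))"
      and X': "spectral_process \<alpha> MX' X' MZ' Z'"
    for MX' :: "'y measure" and X' :: "'y \<Rightarrow> real ^ 'p \<Rightarrow> real ^ 'd"
  proof -
    have "max_stable_law \<alpha> ?Q = max_stable_law \<alpha> ?Q'"
    proof (rule max_stable_law_eq_of_tilts[OF \<open>0 < \<alpha>\<close> nrm Q Q'])
      fix G :: "(real ^ 'p \<Rightarrow> real ^ 'd) \<Rightarrow> ennreal" and h :: "real ^ 'p" assume G: "G \<in> homogeneous_maps 0"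
      then have "(\<lambda>f. ennreal (nrm (f h) powr \<alpha>) * G f) \<in> borel_measurable path_space"
        by (intro borel_measurable_times_ennreal normm) (simp add: homogeneous_maps_def)
      then show "(\<integral>\<^sup>+f. ennreal (nrm (f h) powr \<alpha>) * G f \<partial>?Q) = (\<integral>\<^sup>+f. ennreal (nrm (f h) powr \<alpha>) * G f \<partial>?Q')"
        using * G by (simp only: int)
    qed
    then show ?thesis using law X' by (simp add: spectral_process_def)
  qed

  fix P :: "'q measure" and \<Theta> :: "real ^ 'p \<Rightarrow> 'q \<Rightarrow> real ^ 'p \<Rightarrow> real ^ 'd"
    and W :: "'q \<Rightarrow> real ^ 'p" and p :: "real ^ 'p \<Rightarrow> real"
  assume "prob_space P \<and>
        (\<forall>h. tilted_process nrm \<alpha> MZ Z h P (\<Theta> h)) \<and>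
        W \<in> P \<rightarrow>\<^sub>M count_space rational_points \<and>
        indep_selector P W \<Theta> \<and>
        (\<forall>t \<in> rational_points. p t = measure P {\<omega> \<in> space P. W \<omega> = t} \<and> p t > 0)"
  then have P: "prob_space P" and \<Theta>: "\<And>h. tilted_process nrm \<alpha> MZ Z h P (\<Theta> h)"
    and W: "W \<in> P \<rightarrow>\<^sub>M count_space rational_points" and indep: "indep_selector P W \<Theta>"
    and p: "\<And>t. t \<in> rational_points \<Longrightarrow> p t = measure P {\<omega> \<in> space P. W \<omega> = t}"
      "\<And>t. t \<in> rational_points \<Longrightarrow> 0 < p t"
    by blast+
  have \<Theta>m: "\<Theta> h \<in> P \<rightarrow>\<^sub>M path_space" for h using \<Theta> by (simp add: tilted_process_def path_process_def)
  obtain r :: "nat \<Rightarrow> real ^ 'p" where r: "bij_betw r UNIV rational_points" using rational_enumeration .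
  have mixed: "mixed_process nrm \<alpha> p W \<Theta> = (\<lambda>\<omega>. normalise nrm \<alpha> r p (\<Theta> (W \<omega>) \<omega>))"
    by (rule ext) (rule mixed_process_eq_normalise[OF r less_imp_le[OF p(2)] nrm])
  have mm: "mixed_process nrm \<alpha> p W \<Theta> \<in> P \<rightarrow>\<^sub>M path_space"
    unfolding mixed
  proof (rule measurable_compose[OF _ measurable_normalise[OF nrm]])
    \<comment> \<open>\<open>W\<close> has countable range, so measurability can be checked on each
      event \<open>W \<omega> = h\<close>, where the process is \<open>\<Theta> h\<close>.\<close>
    show "(\<lambda>\<omega>. \<Theta> (W \<omega>) \<omega>) \<in> P \<rightarrow>\<^sub>M path_space"
      using \<Theta>m W countable_rational_points by (rule measurable_compose_countable'[where f=\<Theta>])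
  qed
  then have mp: "path_process P (mixed_process nrm \<alpha> p W \<Theta>)" using P by (simp add: path_process_def)
  have "max_stable_law \<alpha> ?Q = max_stable_law \<alpha> (distr P path_space (mixed_process nrm \<alpha> p W \<Theta>))"
  proof (rule max_stable_law_eqI[OF \<open>0 < \<alpha>\<close> Q prob_space_path_law[OF mp] sets_distr])
    fix J :: "(((real ^ 'p) \<times> 'd) \<times> real) set" assume J: "constraints J"
    have "(\<integral>\<^sup>+f. level \<alpha> J f \<partial>distr P path_space (mixed_process nrm \<alpha> p W \<Theta>))
        = (\<integral>\<^sup>+\<omega>. level \<alpha> J (normalise nrm \<alpha> r p (\<Theta> (W \<omega>) \<omega>)) \<partial>P)"
      unfolding mixed
      by (rule nn_integral_distr[OF mm[unfolded mixed]]) (simp only: measurable_distr_eq1 measurable_level[OF J])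
    \<comment> \<open>A level is \<alpha>-homogeneous and vanishes at the zero path, as the mixture
      formula demands of \<open>H\<close>; agreement of all levels is agreement of the max-stable
      laws.\<close>
    also have "\<dots> = (\<integral>\<^sup>+f. level \<alpha> J f \<partial>?Q)"
      by (rule nn_integral_mixture[OF \<open>0 < \<alpha>\<close> nrm Q(2) unit P \<Theta>m
            tilted_process_law[OF nrm Zm assms(7) \<Theta>] W indep_selectorD[OF P indep] p r
            level_in_homogeneous_maps[OF J] level_zero[OF \<open>0 < \<alpha>\<close>]])
    finally show "(\<integral>\<^sup>+f. level \<alpha> J f \<partial>?Q)
        = (\<integral>\<^sup>+f. level \<alpha> J f \<partial>distr P path_space (mixed_process nrm \<alpha> p W \<Theta>))" ..
  qed
  then show "spectral_process \<alpha> MX X P (mixed_process nrm \<alpha> p W \<Theta>)"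
    using X mp law by (simp add: spectral_process_def)
qed

end
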